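(* Let $d>1$ be an integer, let $\alpha,\beta\in\mathbb{C}^d$, $b,b'\in\mathbb{C}$, and let $V,V'$ be two irreducible $\mathfrak{sl}_d$-modules. Then the $\mathcal{W}_d$-modules $F^\alpha_b(V)$ and $F^\beta_{b'}(V')$ are isomorphic if and only if $b=b'$, $\alpha-\beta\in\mathbb{Z}^d$, and $V\cong V'$ as $\mathfrak{sl}_d$-modules.
   Context: $\mathfrak{gl}_d$ is the Lie algebra of all $d\times d$ complex matrices, with matrix units $E_{ij}$, and $\mathfrak{sl}_d$ is its subalgebra of traceless matrices. $\mathcal{W}_d$ is the Lie algebra of derivations of the Laurent polynomial algebra $A_d=\mathbb{C}[x_1^{\pm1},\dots,x_d^{\pm1}]$. Elements of $\mathbb{C}^d$ and $\mathbb{Z}^d$ are column vectors, $(u\mid v)=u^Tv$, $x^r=x_1^{r_1}\cdots x_d^{r_d}$ for $r\in\mathbb{Z}^d$, and $\partial_i=x_i\frac{\partial}{\partial x_i}$. For $u\in\mathbb{C}^d$, $r\in\mathbb{Z}^d$ put $D(u,r)=x^r\sum_{i=1}^d u_i\partial_i$; these elements span $\mathcal{W}_d$, and $[D(u,r),D(v,s)]=D(w,r+s)$ with $w=(u\mid s)v-(v\mid r)u$. For $\alpha\in\mathbb{C}^d$, $b\in\mathbb{C}$ and an $\mathfrak{sl}_d$-module $V$, regard $V$ as a $\mathfrak{gl}_d$-module by letting the identity matrix act as the scalar $b$. The $\mathcal{W}_d$-module $F^\alpha_b(V)$ is then the vector space $V\otimes A_d$ with action $$D(u,r)\,v(n)=\Big((u\mid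 n+\alpha)v+(ru^T)v\Big)(n+r),\qquad u\in\mathbb{C}^d,\ v\in V,\ n,r\in\mathbb{Z}^d,$$ where $v(n)=v\otimes x^n$ and $ru^T=\sum_{i,j}r_iu_jE_{ij}\in\mathfrak{gl}_d$ acts through the $\mathfrak{gl}_d$-module structure on $V$. Modules need not be finite dimensional or weight modules. *)

theory Defs
  imports "HOL-Analysis.Analysis" "HOL-Library.Poly_Mapping" "HOL-Library.Function_Algebras"
begin

section \<open>Lie algebras over the complex numbers and their modules\<close>

text \<open>
  A Lie algebra is a subspace of an ambient vector space, so that matrix algebras and algebras of
  operators are treated alike.  Its addition is that of the type (pointwise for operators).
\<close>

record 'g lie_data =
  lie_carrier :: "'g set"
  lie_scale :: "complex \<Rightarrow> 'g \<Rightarrow> 'g"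
  lie_bracket :: "'g \<Rightarrow> 'g \<Rightarrow> 'g"

locale lie_algebra =
  vector_space "lie_scale L" for L :: "'g::ab_group_add lie_data" +
  assumes carrier_subspace: "subspace (lie_carrier L)"
    and bracket_closed: "\<lbrakk>x \<in> lie_carrier L; y \<in> lie_carrier L\<rbrakk> \<Longrightarrow> lie_bracket L x y \<in> lie_carrier L"
    and bracket_add_left: "\<lbrakk>x \<in> lie_carrier L; y \<in> lie_carrier L; z \<in> lie_carrier L\<rbrakk> \<Longrightarrow>
          lie_bracket L (x + y) z = lie_bracket L x z + lie_bracket L y z"
    and bracket_scale_left: "\<lbrakk>x \<in> lie_carrier L; y \<in> lie_carrier L\<rbrakk> \<Longrightarrow>
          lie_bracket L (lie_scale L c x) y = lie_scale L c (lie_bracket L x y)"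
    and bracket_self: "x \<in> lie_carrier L \<Longrightarrow> lie_bracket L x x = 0"
    and jacobi: "\<lbrakk>x \<in> lie_carrier L; y \<in> lie_carrier L; z \<in> lie_carrier L\<rbrakk> \<Longrightarrow>
          lie_bracket L x (lie_bracket L y z) + lie_bracket L y (lie_bracket L z x)
            + lie_bracket L z (lie_bracket L x y) = 0"

text \<open>
  The module is the whole type \<open>'v\<close> with scalar multiplication \<open>sV\<close>; the values of the action
  \<open>act\<close> outside the carrier of \<open>L\<close> are irrelevant.
\<close>

locale lie_module = L: lie_algebra L + V: vector_space sV
  for L :: "'g::ab_group_add lie_data" and sV :: "complex \<Rightarrow> 'v::ab_group_add \<Rightarrow> 'v" +
  fixes act :: "'g \<Rightarrow> 'v \<Rightarrow> 'v"
  assumes act_linear: "x \<in> lie_carrier L \<Longrightarrow> Vector_Spaces.linear sV sV (act x)"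
    and act_add: "\<lbrakk>x \<in> lie_carrier L; y \<in> lie_carrier L\<rbrakk> \<Longrightarrow> act (x + y) v = act x v + act y v"
    and act_scale: "x \<in> lie_carrier L \<Longrightarrow> act (lie_scale L c x) v = sV c (act x v)"
    and act_bracket: "\<lbrakk>x \<in> lie_carrier L; y \<in> lie_carrier L\<rbrakk> \<Longrightarrow>
          act (lie_bracket L x y) v = act x (act y v) - act y (act x v)"

definition irreducible_lie_module ::
  "'g::ab_group_add lie_data \<Rightarrow> (complex \<Rightarrow> 'v::ab_group_add \<Rightarrow> 'v) \<Rightarrow> ('g \<Rightarrow> 'v \<Rightarrow> 'v) \<Rightarrow> bool"
  where "irreducible_lie_module L sV act \<longleftrightarrow>
    lie_module L sV act \<and> (\<exists>v::'v. v \<noteq> 0) \<and>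
    (\<forall>U. module.subspace sV U \<and> (\<forall>x\<in>lie_carrier L. \<forall>v\<in>U. act x v \<in> U) \<longrightarrow> U = {0} \<or> U = UNIV)"

definition lie_module_isomorphic ::
  "'g lie_data \<Rightarrow> (complex \<Rightarrow> 'v::ab_group_add \<Rightarrow> 'v) \<Rightarrow> ('g \<Rightarrow> 'v \<Rightarrow> 'v) \<Rightarrow>
    (complex \<Rightarrow> 'w::ab_group_add \<Rightarrow> 'w) \<Rightarrow> ('g \<Rightarrow> 'w \<Rightarrow> 'w) \<Rightarrow> bool"
  where "lie_module_isomorphic L sV actV sW actW \<longleftrightarrow>
    (\<exists>\<phi>. Vector_Spaces.linear sV sW \<phi> \<and> bij \<phi> \<and>
      (\<forall>x\<in>lie_carrier L. \<forall>v. \<phi> (actV x v) = actW x (\<phi> v)))"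


section \<open>Matrices\<close>

definition sl :: "(complex^'d^'d) lie_data"
  where "sl = \<lparr>lie_carrier = {A. trace A = 0}, lie_scale = (\<lambda>c. map_matrix ((*) c)),
               lie_bracket = (\<lambda>A B. A ** B - B ** A)\<rparr>"

text \<open>
  The \<open>gl\<close>-module obtained from an \<open>sl\<close>-module by letting the identity matrix act as \<open>b\<close>,
  via \<open>A = (A - (tr A / d) I) + (tr A / d) I\<close>.
\<close>

definition gl_act ::
  "complex \<Rightarrow> (complex \<Rightarrow> 'v::ab_group_add \<Rightarrow> 'v) \<Rightarrow> (complex^'d^'d \<Rightarrow> 'v \<Rightarrow> 'v) \<Rightarrow>
    complex^'d^'d \<Rightarrow> 'v \<Rightarrow> 'v"
  where "gl_act b sV \<rho> A v =
    \<rho> (A - mat (trace A / of_nat CARD('d))) v + sV (b * (trace A / of_nat CARD('d))) v"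

definition int_vec :: "int^'d \<Rightarrow> complex^'d"
  where "int_vec n = (\<chi> i. of_int (n $ i))"

text \<open>The bilinear (not Hermitian) form \<open>(u | v) = u\<^sup>T v\<close>, and the matrix \<open>r u\<^sup>T\<close>.\<close>

definition bilin :: "complex^'d \<Rightarrow> complex^'d \<Rightarrow> complex"
  where "bilin u v = (\<Sum>i\<in>UNIV. u $ i * v $ i)"

definition outer :: "complex^'d \<Rightarrow> complex^'d \<Rightarrow> complex^'d^'d"
  where "outer r u = (\<chi> i j. r $ i * u $ j)"


section \<open>Laurent polynomials and their derivations\<close>

text \<open>
  \<open>A\<^sub>d\<close> is the group algebra of \<open>\<int>\<^sup>d\<close>: the type of finitely supported functions with its convolution
  product; \<open>x\<^sup>n\<close> is \<^term>\<open>Poly_Mapping.single n 1\<close>.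
\<close>

type_synonym 'd laurent = "(int^'d) \<Rightarrow>\<^sub>0 complex"

definition pscale :: "(complex \<Rightarrow> 'v::ab_group_add \<Rightarrow> 'v) \<Rightarrow> complex \<Rightarrow> ('k \<Rightarrow>\<^sub>0 'v) \<Rightarrow> ('k \<Rightarrow>\<^sub>0 'v)"
  where "pscale s c f = Poly_Mapping.map (s c) f"

definition derivations :: "('d::finite laurent \<Rightarrow> 'd laurent) set"
  where "derivations = {\<delta>. Vector_Spaces.linear (pscale (*)) (pscale (*)) \<delta> \<and>
                           (\<forall>f g. \<delta> (f * g) = \<delta> f * g + f * \<delta> g)}"

definition Witt :: "('d::finite laurent \<Rightarrow> 'd laurent) lie_data"
  where "Witt = \<lparr>lie_carrier = derivations, lie_scale = (\<lambda>c \<delta> f. pscale (*) c (\<delta> f)),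
                 lie_bracket = (\<lambda>\<delta> \<epsilon>. (\<delta> \<circ> \<epsilon>) - (\<epsilon> \<circ> \<delta>))\<rparr>"

definition euler_deriv :: "'d::finite \<Rightarrow> 'd laurent \<Rightarrow> 'd laurent"
  where "euler_deriv i f = Poly_Mapping.mapp (\<lambda>n c. of_int (n $ i) * c) f"

definition D :: "complex^'d \<Rightarrow> int^'d \<Rightarrow> 'd::finite laurent \<Rightarrow> 'd laurent"
  where "D u r f = Poly_Mapping.single r 1 * (\<Sum>i\<in>UNIV. pscale (*) (u $ i) (euler_deriv i f))"

text \<open>
  Every derivation is a finite sum \<open>\<delta> = \<Sum>\<^sub>r D(u\<^sub>r, r)\<close> with unique \<open>u\<^sub>r\<close>, and
  \<open>\<delta>(x\<^sub>i) = \<Sum>\<^sub>r (u\<^sub>r)\<^sub>i x\<^sup>r x\<^sub>i\<close>, so the coefficients \<open>u\<^sub>r\<close> can be read off from the images of the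
  variables (see \<open>derivation_expand\<close> and \<open>W_coeff_D\<close> below).
\<close>

definition W_coeff :: "('d::finite laurent \<Rightarrow> 'd laurent) \<Rightarrow> int^'d \<Rightarrow> complex^'d"
  where "W_coeff \<delta> r =
    (\<chi> i. Poly_Mapping.lookup (\<delta> (Poly_Mapping.single (axis i 1) 1)) (r + axis i 1))"

definition W_modes :: "('d::finite laurent \<Rightarrow> 'd laurent) \<Rightarrow> (int^'d) set"
  where "W_modes \<delta> = {r. W_coeff \<delta> r \<noteq> 0}"


section \<open>The modules \<open>F\<^sup>\<alpha>\<^sub>b(V)\<close>\<close>

text \<open>
  \<open>V \<otimes> A\<^sub>d\<close> is the space of finitely supported functions \<open>\<int>\<^sup>d \<Rightarrow> V\<close>, with scalar multiplication
  \<^term>\<open>pscale sV\<close>; \<open>v(n) = v \<otimes> x\<^sup>n\<close> is \<^term>\<open>Poly_Mapping.single n v\<close>.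
  \<open>F_D\<close> is the action of \<open>D(u, r)\<close>, and \<open>F_act\<close> its linear extension to all derivations.
\<close>

definition F_D ::
  "complex^'d \<Rightarrow> complex \<Rightarrow> (complex \<Rightarrow> 'v::ab_group_add \<Rightarrow> 'v) \<Rightarrow> (complex^'d^'d \<Rightarrow> 'v \<Rightarrow> 'v) \<Rightarrow>
    complex^'d \<Rightarrow> int^'d \<Rightarrow> ((int^'d) \<Rightarrow>\<^sub>0 'v) \<Rightarrow> ((int^'d) \<Rightarrow>\<^sub>0 'v)"
  where "F_D \<alpha> b sV \<rho> u r f =
    (\<Sum>n\<in>Poly_Mapping.keys f. Poly_Mapping.single (n + r)
       (sV (bilin u (int_vec n + \<alpha>)) (Poly_Mapping.lookup f n)
        + gl_act b sV \<rho> (outer (int_vec r) u) (Poly_Mapping.lookup f n)))"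

definition F_act ::
  "complex^'d \<Rightarrow> complex \<Rightarrow> (complex \<Rightarrow> 'v::ab_group_add \<Rightarrow> 'v) \<Rightarrow> (complex^'d^'d \<Rightarrow> 'v \<Rightarrow> 'v) \<Rightarrow>
    ('d::finite laurent \<Rightarrow> 'd laurent) \<Rightarrow> ((int^'d) \<Rightarrow>\<^sub>0 'v) \<Rightarrow> ((int^'d) \<Rightarrow>\<^sub>0 'v)"
  where "F_act \<alpha> b sV \<rho> \<delta> f = (\<Sum>r\<in>W_modes \<delta>. F_D \<alpha> b sV \<rho> (W_coeff \<delta> r) r f)"


section \<open>Consistency of the definitions\<close>

lemma lookup_pscale:
  assumes "vector_space s"
  shows "Poly_Mapping.lookup (pscale s c f) k = s c (Poly_Mapping.lookup f k)"
proof -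
  interpret vector_space s by fact
  show ?thesis by (simp add: pscale_def map.rep_eq when_def)
qed

lemma vector_space_pscale:
  assumes "vector_space s"
  shows "vector_space (pscale s :: complex \<Rightarrow> ('k \<Rightarrow>\<^sub>0 'v::ab_group_add) \<Rightarrow> _)"
proof -
  interpret vector_space s by fact
  show ?thesis
    by unfold_locales
      (auto intro!: poly_mapping_eqI simp: lookup_pscale[OF assms] lookup_add
         scale_right_distrib scale_left_distrib)
qed

lemma vector_space_complex: "vector_space ((*) :: complex \<Rightarrow> complex \<Rightarrow> complex)"
  by unfold_locales (auto simp: algebra_simps)

lemmas lookup_pscale_complex = lookup_pscale[OF vector_space_complex]
lemmas vector_space_laurent = vector_space_pscale[OF vector_space_complex]

lemma pscale_laurent: "pscale (*) c (f :: 'd::finite laurent) = Poly_Mapping.single 0 c * f"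
proof (rule poly_mapping_eqI)
  fix k
  show "Poly_Mapping.lookup (pscale (*) c f) k = Poly_Mapping.lookup (Poly_Mapping.single 0 c * f) k"
    by (simp add: lookup_pscale_complex lookup_mult lookup_single when_mult mult_when)
qed

lemma poly_mapping_sum_single:
  "(\<Sum>k\<in>Poly_Mapping.keys f. Poly_Mapping.single k (Poly_Mapping.lookup f k)) = f"
proof (rule poly_mapping_eqI)
  fix k
  have "Poly_Mapping.lookup (\<Sum>k\<in>Poly_Mapping.keys f. Poly_Mapping.single k (Poly_Mapping.lookup f k)) k
      = (\<Sum>j\<in>Poly_Mapping.keys f. if j = k then Poly_Mapping.lookup f k else 0)"
    unfolding lookup_sum by (intro sum.cong) (auto simp: lookup_single when_def)
  then show "Poly_Mapping.lookup (\<Sum>k\<in>Poly_Mapping.keys f. Poly_Mapping.single k (Poly_Mapping.lookup f k)) k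
      = Poly_Mapping.lookup f k"
    by (simp add: in_keys_iff)
qed

lemma additive_ext:
  fixes g h :: "('k \<Rightarrow>\<^sub>0 'v::ab_group_add) \<Rightarrow> 'w::ab_group_add"
  assumes "\<And>x y. g (x + y) = g x + g y" "\<And>x y. h (x + y) = h x + h y"
    and "\<And>k v. g (Poly_Mapping.single k v) = h (Poly_Mapping.single k v)"
  shows "g f = h f"
proof -
  have g0: "g 0 = 0" and h0: "h 0 = 0"
    using assms(1)[of 0 0] assms(2)[of 0 0] by simp_all
  have gs: "g (sum F A) = (\<Sum>a\<in>A. g (F a))" for F :: "'k \<Rightarrow> _" and A
    by (induction A rule: infinite_finite_induct) (auto simp: g0 assms)
  have hs: "h (sum F A) = (\<Sum>a\<in>A. h (F a))" for F :: "'k \<Rightarrow> _" and A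
    by (induction A rule: infinite_finite_induct) (auto simp: h0 assms)
  have "g f = g (\<Sum>k\<in>Poly_Mapping.keys f. Poly_Mapping.single k (Poly_Mapping.lookup f k))"
    by (simp add: poly_mapping_sum_single)
  also have "\<dots> = h (\<Sum>k\<in>Poly_Mapping.keys f. Poly_Mapping.single k (Poly_Mapping.lookup f k))"
    by (simp only: gs hs assms(3))
  finally show ?thesis by (simp add: poly_mapping_sum_single)
qed

lemma sl_lie_algebra: "lie_algebra (sl :: (complex^'d^'d) lie_data)"
proof -
  interpret vector_space "\<lambda>c. map_matrix ((*) c) :: complex^'d^'d \<Rightarrow> complex^'d^'d"
    by unfold_locales (auto simp: vec_eq_iff algebra_simps)
  have m: "map_matrix ((*) c) A ** B = map_matrix ((*) c) (A ** B)"
    "B ** map_matrix ((*) c) A = map_matrix ((*) c) (B ** A)" for c and A B :: "complex^'d^'d"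
    by (auto simp: vec_eq_iff matrix_matrix_mult_def sum_distrib_left algebra_simps)
  have rd: "(A + B) ** C = A ** C + B ** C" for A B C :: "complex^'d^'d"
    by (simp add: vec_eq_iff matrix_matrix_mult_def algebra_simps sum.distrib)
  have rs: "(A - B) ** C = A ** C - B ** C" "C ** (A - B) = C ** A - C ** B" for A B C :: "complex^'d^'d"
    by (simp_all add: vec_eq_iff matrix_matrix_mult_def algebra_simps sum_subtractf)
  have tm: "trace (map_matrix ((*) c) A) = c * trace A" for c and A :: "complex^'d^'d"
    by (simp add: trace_def sum_distrib_left)
  show ?thesis
    by unfold_locales
      (auto simp: sl_def tm trace_0[unfolded mat_0] scale_right_distrib scale_left_distrib trace_sub trace_add m rd
        scale_right_diff_distrib matrix_add_ldistrib rs
        matrix_mul_assoc intro!: subspaceI intro: trace_mul_sym)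
qed

lemma gl_act_mat:
  fixes \<rho> :: "complex^'d^'d \<Rightarrow> 'v::ab_group_add \<Rightarrow> 'v"
  assumes "lie_module sl sV \<rho>"
  shows "gl_act b sV \<rho> (mat c) v = sV (b * c) v"
proof -
  interpret lie_module sl sV \<rho> by fact
  have "\<rho> 0 v = 0"
  proof -
    have "map_matrix ((*) 0) 0 = (0 :: complex^'d^'d)"
      by (simp add: vec_eq_iff)
    moreover have "\<rho> (map_matrix ((*) 0) 0) v = 0"
      using act_scale[of 0 0 v] by (simp add: sl_def trace_def)
    ultimately show ?thesis by metis
  qed
  moreover have "trace (mat c :: complex^'d^'d) = of_nat CARD('d) * c"
    by (simp add: trace_def mat_def)
  ultimately show ?thesis
    by (simp add: gl_act_def)
qed

lemma gl_act_sl: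
  assumes "lie_module sl sV \<rho>" "trace A = 0"
  shows "gl_act b sV \<rho> A v = \<rho> A v"
proof -
  interpret lie_module sl sV \<rho> by fact
  show ?thesis
    using assms(2) by (simp add: gl_act_def mat_0)
qed

lemma lookup_euler_deriv:
  "Poly_Mapping.lookup (euler_deriv i f) n = of_int (n $ i) * Poly_Mapping.lookup f n"
  by (auto simp: euler_deriv_def lookup_mapp when_def in_keys_iff)

lemma lookup_D:
  "Poly_Mapping.lookup (D u r f) n = bilin u (int_vec (n - r)) * Poly_Mapping.lookup f (n - r)"
proof -
  have *: "Poly_Mapping.lookup (Poly_Mapping.single r 1 * g) n = Poly_Mapping.lookup g (n - r)"
    for g :: "'a laurent"
  proof -
    have "(n = r + q) = (q = n - r)" for q by auto
    then show ?thesis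
      by (simp add: lookup_mult lookup_single when_mult mult_when)
  qed
  show ?thesis
    by (simp add: D_def * lookup_sum lookup_pscale_complex lookup_euler_deriv bilin_def int_vec_def
        sum_distrib_right mult.assoc)
qed

lemma D_add: "D u r (f + g) = D u r f + D u r g"
  by (rule poly_mapping_eqI) (simp add: lookup_D lookup_add algebra_simps)

lemma D_scale: "D u r (pscale (*) c f) = pscale (*) c (D u r f)"
  by (rule poly_mapping_eqI) (simp add: lookup_D lookup_pscale_complex)

lemma D_single:
  "D u r (Poly_Mapping.single n c) = Poly_Mapping.single (n + r) (bilin u (int_vec n) * c)"
  by (rule poly_mapping_eqI) (auto simp: lookup_D lookup_single when_def)

lemma bilin_simps:
  "bilin u (v + w) = bilin u v + bilin u w"
  "bilin (u + v) w = bilin u w + bilin v w"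
  "bilin u (v - w) = bilin u v - bilin u w"
  "bilin (u - v) w = bilin u w - bilin v w"
  "bilin (c *s u) w = c * bilin u w"
  "bilin u (c *s w) = c * bilin u w"
  by (simp_all add: bilin_def algebra_simps sum.distrib sum_subtractf sum_distrib_left)

lemma D_zero: "D u r 0 = 0"
  using D_add[of u r 0 0] by simp

lemma int_vec_simps:
  "int_vec (m + n) = int_vec m + int_vec n" "int_vec (m - n) = int_vec m - int_vec n"
  "int_vec 0 = 0" "int_vec (- n) = - int_vec n"
  by (simp_all add: int_vec_def vec_eq_iff)

lemma derivationsD:
  assumes "\<delta> \<in> derivations"
  shows "\<delta> (f + g) = \<delta> f + \<delta> g" "\<delta> (pscale (*) c f) = pscale (*) c (\<delta> f)"
    "\<delta> (f * g) = \<delta> f * g + f * \<delta> g"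
  using assms
  by (auto simp: derivations_def linear_iff_module_hom module_hom_iff)

lemma derivationsI:
  assumes "\<And>f g. \<delta> (f + g) = \<delta> f + \<delta> g" "\<And>c f. \<delta> (pscale (*) c f) = pscale (*) c (\<delta> f)"
    "\<And>f g. \<delta> (f * g) = \<delta> f * g + f * \<delta> g"
  shows "\<delta> \<in> derivations"
  using assms vector_space_laurent
  by (auto simp: derivations_def linear_iff_module_hom module_hom_iff module_iff_vector_space)

lemma D_derivation: "D u r \<in> derivations"
proof (rule derivationsI)
  fix f g :: "'a laurent"
  show "D u r (f * g) = D u r f * g + f * D u r g"
  proof (rule additive_ext[where f = f])
    fix m a
    show "D u r (Poly_Mapping.single m a * g) =
        D u r (Poly_Mapping.single m a) * g + Poly_Mapping.single m a * D u r g"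
    proof (rule additive_ext[where f = g])
      fix n c
      show "D u r (Poly_Mapping.single m a * Poly_Mapping.single n c) =
        D u r (Poly_Mapping.single m a) * Poly_Mapping.single n c +
        Poly_Mapping.single m a * D u r (Poly_Mapping.single n c)"
        by (simp add: mult_single D_single single_add[symmetric] bilin_simps int_vec_simps
            algebra_simps)
    qed (simp_all add: algebra_simps D_add)
  qed (simp_all add: algebra_simps D_add)
qed (simp_all add: D_add D_scale)

lemma D_bracket:
  "lie_bracket Witt (D u r) (D v s) =
     D (bilin u (int_vec s) *s v - bilin v (int_vec r) *s u) (r + s)"
proof
  fix f
  have "D u r (D v s f) - D v s (D u r f) =
     D (bilin u (int_vec s) *s v - bilin v (int_vec r) *s u) (r + s) f"
  proof (rule poly_mapping_eqI)
    fix k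
    have "k - r - s = k - (r + s)" "k - s - r = k - (r + s)" by simp_all
    then show "Poly_Mapping.lookup (D u r (D v s f) - D v s (D u r f)) k = Poly_Mapping.lookup
       (D (bilin u (int_vec s) *s v - bilin v (int_vec r) *s u) (r + s) f) k"
      by (simp add: lookup_minus lookup_D) (simp add: bilin_simps int_vec_simps algebra_simps)
  qed
  then show "lie_bracket Witt (D u r) (D v s) f =
     D (bilin u (int_vec s) *s v - bilin v (int_vec r) *s u) (r + s) f"
    by (simp add: Witt_def)
qed

lemma int_vec_axis: "bilin u (int_vec (axis i 1)) = u $ i"
proof -
  have "bilin u (int_vec (axis i 1)) = (\<Sum>j\<in>UNIV. if j = i then u $ j else 0)"
    unfolding bilin_def by (intro sum.cong) (auto simp: int_vec_def axis_def)
  then show ?thesis by simp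
qed

lemma W_coeff_D: "W_coeff (D u r) s = (if s = r then u else 0)"
  by (auto simp: W_coeff_def vec_eq_iff D_single int_vec_axis lookup_single when_def)

lemma finite_W_modes: "finite (W_modes \<delta>)"
proof -
  have "W_modes \<delta> \<subseteq> (\<Union>i. (\<lambda>k. k - axis i 1) ` Poly_Mapping.keys (\<delta> (Poly_Mapping.single (axis i 1) 1)))"
  proof
    fix r assume "r \<in> W_modes \<delta>"
    then obtain i where "Poly_Mapping.lookup (\<delta> (Poly_Mapping.single (axis i 1) 1)) (r + axis i 1) \<noteq> 0"
      by (auto simp: W_modes_def W_coeff_def vec_eq_iff)
    then have "r + axis i 1 \<in> Poly_Mapping.keys (\<delta> (Poly_Mapping.single (axis i 1) 1))"
      by (simp add: in_keys_iff)
    then show "r \<in> (\<Union>i. (\<lambda>k. k - axis i 1) ` Poly_Mapping.keys (\<delta> (Poly_Mapping.single (axis i 1) 1)))"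
      by (force simp: image_iff)
  qed
  then show ?thesis
    by (rule finite_subset) auto
qed

lemma derivation_eq_0:
  assumes \<delta>: "\<delta> \<in> derivations" and var: "\<And>i. \<delta> (Poly_Mapping.single (axis i 1) 1) = 0"
  shows "\<delta> f = 0"
proof -
  define S where "S = {n. \<delta> (Poly_Mapping.single n 1) = 0}"
  have add: "m + n \<in> S" if "m \<in> S" "n \<in> S" for m n
  proof -
    have "\<delta> (Poly_Mapping.single m 1 * Poly_Mapping.single n 1) = 0"
      using that unfolding derivationsD(3)[OF \<delta>] by (simp add: S_def)
    then show ?thesis by (simp add: S_def mult_single)
  qed
  have one: "\<delta> 1 = 0"
    using derivationsD(3)[OF \<delta>, of 1 1] by simp
  then have zero: "0 \<in> S" by (simp add: S_def)
  have neg: "- n \<in> S" if "n \<in> S" for n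
  proof -
    have 1: "Poly_Mapping.single n 1 * Poly_Mapping.single (- n) (1::complex) = 1"
      by (simp add: mult_single)
    have "Poly_Mapping.single n 1 * \<delta> (Poly_Mapping.single (- n) 1) = 0"
      using derivationsD(3)[OF \<delta>, of "Poly_Mapping.single n 1" "Poly_Mapping.single (- n) 1"] that one
      unfolding 1 by (simp add: S_def)
    then have "Poly_Mapping.single (- n) 1 * (Poly_Mapping.single n 1 * \<delta> (Poly_Mapping.single (- n) 1)) = 0"
      by simp
    then have "(Poly_Mapping.single n 1 * Poly_Mapping.single (- n) 1) * \<delta> (Poly_Mapping.single (- n) 1) = 0"
      by (simp only: ac_simps)
    then show ?thesis unfolding 1 by (simp add: S_def)
  qed
  have axis: "axis i k \<in> S" for i and k :: int
  proof (induction k rule: int_induct[where k = 0])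
    case base
    show ?case using zero by (simp add: axis_def zero_vec_def[symmetric] vec_eq_iff cong: if_cong)
  next
    case (step1 k)
    have "axis i (k + 1) = axis i k + axis i (1::int)" by (auto simp: axis_def vec_eq_iff)
    then show ?case using add[OF step1.IH, of "axis i 1"] var by (simp add: S_def)
  next
    case (step2 k)
    have "axis i (k - 1) = axis i k + - axis i (1::int)" by (auto simp: axis_def vec_eq_iff)
    then show ?case using add[OF step2.IH neg, of "axis i 1"] var by (simp add: S_def)
  qed
  have "n \<in> S" for n
  proof -
    have "(\<Sum>i\<in>I. axis i (n $ i)) \<in> S" for I
      by (induction I rule: infinite_finite_induct) (auto simp: zero add axis)
    moreover have "(\<Sum>i\<in>UNIV. axis i (n $ i)) = n"
      by (simp add: vec_eq_iff axis_def)
    ultimately show ?thesis by metis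
  qed
  then have mono: "\<delta> (Poly_Mapping.single n c) = 0" for n c
  proof -
    have "Poly_Mapping.single n c = pscale (*) c (Poly_Mapping.single n 1)"
      by (simp add: pscale_laurent mult_single)
    then show ?thesis
      using derivationsD(2)[OF \<delta>, of c "Poly_Mapping.single n 1"] \<open>n \<in> S\<close>
      by (simp add: S_def pscale_laurent)
  qed
  show ?thesis
    by (rule additive_ext[where f = f and h = "\<lambda>_. 0"]) (simp_all add: derivationsD[OF \<delta>] mono)
qed

lemma derivation_expand:
  assumes \<delta>: "\<delta> \<in> derivations"
  shows "\<delta> f = (\<Sum>r\<in>W_modes \<delta>. D (W_coeff \<delta> r) r f)"
proof -
  let ?E = "\<lambda>f. \<Sum>r\<in>W_modes \<delta>. D (W_coeff \<delta> r) r f"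
  have 1: "(\<lambda>f. \<delta> f - ?E f) \<in> derivations"
  proof (rule derivationsI)
    fix f g :: "'a laurent" and c
    show "\<delta> (f + g) - ?E (f + g) = \<delta> f - ?E f + (\<delta> g - ?E g)"
      by (simp add: derivationsD[OF \<delta>] D_add sum.distrib)
    show "\<delta> (pscale (*) c f) - ?E (pscale (*) c f) = pscale (*) c (\<delta> f - ?E f)"
      by (simp add: derivationsD[OF \<delta>] D_scale)
        (simp add: pscale_laurent sum_distrib_left right_diff_distrib)
    show "\<delta> (f * g) - ?E (f * g) = (\<delta> f - ?E f) * g + f * (\<delta> g - ?E g)"
      by (simp add: derivationsD[OF \<delta>] derivationsD(3)[OF D_derivation] sum.distrib
          sum_distrib_left sum_distrib_right algebra_simps)
  qed
  have "\<delta> (Poly_Mapping.single (axis i 1) 1) - ?E (Poly_Mapping.single (axis i 1) 1) = 0" for i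
  proof (rule poly_mapping_eqI)
    fix k
    have "(\<Sum>r\<in>W_modes \<delta>. Poly_Mapping.lookup (D (W_coeff \<delta> r) r (Poly_Mapping.single (axis i 1) 1)) k)
        = (\<Sum>r\<in>W_modes \<delta>. if r = k - axis i 1 then W_coeff \<delta> r $ i else 0)"
      by (intro sum.cong) (auto simp: D_single int_vec_axis lookup_single when_def)
    also have "\<dots> = W_coeff \<delta> (k - axis i 1) $ i"
      unfolding sum.delta[OF finite_W_modes] by (auto simp: W_modes_def)
    finally show "Poly_Mapping.lookup (\<delta> (Poly_Mapping.single (axis i 1) 1) - ?E (Poly_Mapping.single (axis i 1) 1)) k
      = Poly_Mapping.lookup 0 k"
      by (simp add: lookup_minus lookup_sum W_coeff_def)
  qed
  from derivation_eq_0[OF 1 this, of f] show ?thesis by simp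
qed

lemma Witt_lie_algebra: "lie_algebra (Witt :: ('d::finite laurent \<Rightarrow> 'd laurent) lie_data)"
proof -
  interpret vector_space "lie_scale (Witt :: ('d laurent \<Rightarrow> 'd laurent) lie_data)"
    using vector_space_laurent[where 'k = "int^'d"]
    by (auto simp: vector_space_def Witt_def fun_eq_iff)
  have diff: "\<delta> (f - g) = \<delta> f - \<delta> g" if "\<delta> \<in> derivations" for \<delta> and f g :: "'d laurent"
    using derivationsD(1)[OF that, of "f - g" g] by simp
  have zero: "\<delta> 0 = 0" if "\<delta> \<in> derivations" for \<delta> :: "'d laurent \<Rightarrow> 'd laurent"
    using derivationsD(1)[OF that, of 0 0] by simp
  show ?thesis
  proof
    show "subspace (lie_carrier Witt)"
    proof (rule subspaceI)
      show "0 \<in> lie_carrier Witt"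
        by (auto simp: Witt_def pscale_laurent intro!: derivationsI)
    next
      fix \<delta> \<epsilon> :: "'d laurent \<Rightarrow> 'd laurent"
      assume "\<delta> \<in> lie_carrier Witt" "\<epsilon> \<in> lie_carrier Witt"
      then have d: "\<delta> \<in> derivations" "\<epsilon> \<in> derivations" by (simp_all add: Witt_def)
      have "\<delta> + \<epsilon> \<in> derivations"
        by (rule derivationsI) (simp_all add: d[THEN derivationsD(1)] d[THEN derivationsD(2)]
          d[THEN derivationsD(3)], simp_all add: pscale_laurent algebra_simps)
      then show "\<delta> + \<epsilon> \<in> lie_carrier Witt" by (simp add: Witt_def)
    next
      fix \<delta> :: "'d laurent \<Rightarrow> 'd laurent" and c
      assume "\<delta> \<in> lie_carrier Witt"
      then have d: "\<delta> \<in> derivations" by (simp add: Witt_def)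
      have "(\<lambda>f. pscale (*) c (\<delta> f)) \<in> derivations"
        by (rule derivationsI) (simp_all add: derivationsD[OF d], simp_all add: pscale_laurent algebra_simps)
      then show "lie_scale Witt c \<delta> \<in> lie_carrier Witt" by (simp add: Witt_def)
    qed
  next
    fix \<delta> \<epsilon> :: "'d laurent \<Rightarrow> 'd laurent"
    assume "\<delta> \<in> lie_carrier Witt" "\<epsilon> \<in> lie_carrier Witt"
    then have d: "\<delta> \<in> derivations" "\<epsilon> \<in> derivations" by (simp_all add: Witt_def)
    show "lie_bracket Witt \<delta> \<epsilon> \<in> lie_carrier Witt"
    proof -
      have "(\<delta> \<circ> \<epsilon>) - (\<epsilon> \<circ> \<delta>) \<in> derivations"
        by (rule derivationsI)
          (simp_all add: d[THEN derivationsD(1)] d[THEN derivationsD(2)] d[THEN derivationsD(3)],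
           simp_all add: pscale_laurent algebra_simps)
      then show ?thesis by (simp add: Witt_def)
    qed
  next
    fix \<delta> \<epsilon> :: "'d laurent \<Rightarrow> 'd laurent" and c
    assume "\<delta> \<in> lie_carrier Witt" "\<epsilon> \<in> lie_carrier Witt"
    then have d: "\<delta> \<in> derivations" "\<epsilon> \<in> derivations" by (simp_all add: Witt_def)
    show "lie_bracket Witt (lie_scale Witt c \<delta>) \<epsilon> = lie_scale Witt c (lie_bracket Witt \<delta> \<epsilon>)"
      by (simp add: Witt_def fun_eq_iff d[THEN derivationsD(2)])
         (simp add: pscale_laurent right_diff_distrib)
  qed (auto simp: Witt_def fun_eq_iff derivationsD(1) diff zero)
qed

lemma sum_fun_apply: "(\<Sum>a\<in>A. F a) x = (\<Sum>a\<in>A. F a x)"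
  by (induction A rule: infinite_finite_induct) auto

context
  fixes sV :: "complex \<Rightarrow> 'v::ab_group_add \<Rightarrow> 'v" and \<rho> :: "complex^'d^'d \<Rightarrow> 'v \<Rightarrow> 'v"
  assumes V: "lie_module sl sV \<rho>"
begin

interpretation lie_module sl sV \<rho> by (fact V)

lemma gl_act_right:
  "gl_act b sV \<rho> A (v + w) = gl_act b sV \<rho> A v + gl_act b sV \<rho> A w"
  "gl_act b sV \<rho> A (sV c v) = sV c (gl_act b sV \<rho> A v)"
proof -
  have "A - mat (trace A / of_nat CARD('d)) \<in> lie_carrier sl"
    by (simp add: sl_def trace_sub) (simp add: trace_def mat_def)
  from act_linear[OF this] interpret l: Vector_Spaces.linear sV sV "\<rho> (A - mat (trace A / of_nat CARD('d)))" .
  show "gl_act b sV \<rho> A (v + w) = gl_act b sV \<rho> A v + gl_act b sV \<rho> A w"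
    by (simp add: gl_act_def l.add V.scale_right_distrib)
  show "gl_act b sV \<rho> A (sV c v) = sV c (gl_act b sV \<rho> A v)"
    by (simp add: gl_act_def l.scale V.scale_right_distrib mult.commute)
qed

lemma traceless_part: "A - mat (trace A / of_nat CARD('d)) \<in> lie_carrier (sl :: (complex^'d^'d) lie_data)"
  by (simp add: sl_def trace_sub) (simp add: trace_def mat_def)

lemma gl_act_left:
  "gl_act b sV \<rho> (A + B) v = gl_act b sV \<rho> A v + gl_act b sV \<rho> B v"
  "gl_act b sV \<rho> (map_matrix ((*) c) A) v = sV c (gl_act b sV \<rho> A v)"
proof -
  let ?m = "\<lambda>A :: complex^'d^'d. mat (trace A / of_nat CARD('d)) :: complex^'d^'d"
  have "A + B - ?m (A + B) = (A - ?m A) + (B - ?m B)"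
    by (simp add: vec_eq_iff mat_def trace_add add_divide_distrib)
  then have "\<rho> (A + B - ?m (A + B)) v = \<rho> (A - ?m A) v + \<rho> (B - ?m B) v"
    by (simp only: act_add[OF traceless_part traceless_part])
  then show "gl_act b sV \<rho> (A + B) v = gl_act b sV \<rho> A v + gl_act b sV \<rho> B v"
    by (simp add: gl_act_def) (simp add: trace_add add_divide_distrib distrib_left V.scale_left_distrib)
  have t: "trace (map_matrix ((*) c) A) = c * trace A"
    by (simp add: trace_def sum_distrib_left)
  have "map_matrix ((*) c) A - ?m (map_matrix ((*) c) A) = lie_scale sl c (A - ?m A)"
    by (simp add: sl_def vec_eq_iff mat_def t right_diff_distrib)
  then have "\<rho> (map_matrix ((*) c) A - ?m (map_matrix ((*) c) A)) v = sV c (\<rho> (A - ?m A) v)"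
    by (simp only: act_scale[OF traceless_part])
  then show "gl_act b sV \<rho> (map_matrix ((*) c) A) v = sV c (gl_act b sV \<rho> A v)"
    by (simp add: gl_act_def) (simp add: t V.scale_right_distrib mult.left_commute)
qed

lemma gl_act_bracket:
  "gl_act b sV \<rho> (A ** B - B ** A) v =
     gl_act b sV \<rho> A (gl_act b sV \<rho> B v) - gl_act b sV \<rho> B (gl_act b sV \<rho> A v)"
proof -
  let ?m = "\<lambda>A :: complex^'d^'d. mat (trace A / of_nat CARD('d)) :: complex^'d^'d"
  let ?c = "\<lambda>A :: complex^'d^'d. b * (trace A / of_nat CARD('d))"
  interpret lA: Vector_Spaces.linear sV sV "\<rho> (A - ?m A)" by (rule act_linear[OF traceless_part])
  interpret lB: Vector_Spaces.linear sV sV "\<rho> (B - ?m B)" by (rule act_linear[OF traceless_part])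
  have m: "mat c ** X = X ** mat c" for c and X :: "complex^'d^'d"
  proof -
    have "mat c ** X = map_matrix ((*) c) X" "X ** mat c = map_matrix ((*) c) X"
      by (simp_all add: vec_eq_iff matrix_matrix_mult_def mat_def if_distrib if_distribR
          mult.commute cong: if_cong)
    then show ?thesis by simp
  qed
  have rs: "(A - B) ** C = A ** C - B ** C" "C ** (A - B) = C ** A - C ** B" for A B C :: "complex^'d^'d"
    by (simp_all add: vec_eq_iff matrix_matrix_mult_def algebra_simps sum_subtractf)
  have eq: "A ** B - B ** A = (A - ?m A) ** (B - ?m B) - (B - ?m B) ** (A - ?m A)"
    unfolding rs m[of _ A] m[of _ B] m[of "trace A / of_nat CARD('d)" "?m B"] by simp
  have tr: "trace (A ** B - B ** A) = 0"
    by (simp add: trace_sub trace_mul_sym[of A B])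
  have "gl_act b sV \<rho> (A ** B - B ** A) v = \<rho> (lie_bracket sl (A - ?m A) (B - ?m B)) v"
    unfolding gl_act_sl[OF V tr] by (subst eq) (simp add: sl_def)
  also have "\<dots> = \<rho> (A - ?m A) (\<rho> (B - ?m B) v) - \<rho> (B - ?m B) (\<rho> (A - ?m A) v)"
    by (rule act_bracket[OF traceless_part traceless_part])
  also
  have cancel: "p - q = p + y + (z + t) - (q + z + (y + t))" for p q y z t :: 'v
    by simp
  have "\<rho> (A - ?m A) (\<rho> (B - ?m B) v) - \<rho> (B - ?m B) (\<rho> (A - ?m A) v)
      = gl_act b sV \<rho> A (gl_act b sV \<rho> B v) - gl_act b sV \<rho> B (gl_act b sV \<rho> A v)"
    unfolding gl_act_def lA.add lB.add lA.scale lB.scale V.scale_right_distrib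
      V.scale_left_commute[of "?c A" "?c B" v]
    by (rule cancel)
  finally show ?thesis .
qed

lemma gl_act_zero: "gl_act b sV \<rho> A 0 = 0"
  using gl_act_right(1)[of b A 0 0] by simp

lemma gl_act_zero_left: "gl_act b sV \<rho> 0 v = 0"
  using gl_act_left(1)[of b 0 0 v] by simp

lemma F_D_superset:
  assumes "finite N" "Poly_Mapping.keys f \<subseteq> N"
  shows "F_D \<alpha> b sV \<rho> u r f = (\<Sum>n\<in>N. Poly_Mapping.single (n + r)
       (sV (bilin u (int_vec n + \<alpha>)) (Poly_Mapping.lookup f n)
        + gl_act b sV \<rho> (outer (int_vec r) u) (Poly_Mapping.lookup f n)))"
  unfolding F_D_def
  by (rule sum.mono_neutral_left[OF assms]) (auto simp: in_keys_iff gl_act_zero)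

lemma F_D_single:
  "F_D \<alpha> b sV \<rho> u r (Poly_Mapping.single n v) =
     Poly_Mapping.single (n + r)
       (sV (bilin u (int_vec n + \<alpha>)) v + gl_act b sV \<rho> (outer (int_vec r) u) v)"
  by (subst F_D_superset[where N = "{n}"]) auto

lemma F_D_right:
  "F_D \<alpha> b sV \<rho> u r (f + g) = F_D \<alpha> b sV \<rho> u r f + F_D \<alpha> b sV \<rho> u r g"
  "F_D \<alpha> b sV \<rho> u r (pscale sV c f) = pscale sV c (F_D \<alpha> b sV \<rho> u r f)"
proof -
  show add: "F_D \<alpha> b sV \<rho> u r (f + g) = F_D \<alpha> b sV \<rho> u r f + F_D \<alpha> b sV \<rho> u r g"
    for f g
  proof -
    let ?N = "Poly_Mapping.keys f \<union> Poly_Mapping.keys g"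
    have N: "finite ?N" "Poly_Mapping.keys (f + g) \<subseteq> ?N" "Poly_Mapping.keys f \<subseteq> ?N"
      "Poly_Mapping.keys g \<subseteq> ?N"
      by (simp_all add: keys_add)
    show ?thesis
      unfolding F_D_superset[OF N(1,2)] F_D_superset[OF N(1,3)] F_D_superset[OF N(1,4)]
        sum.distrib[symmetric] single_add[symmetric]
      by (intro sum.cong refl arg_cong[where f = "Poly_Mapping.single _"])
        (simp add: lookup_add gl_act_right V.scale_right_distrib)
  qed
  interpret P: vector_space "pscale sV :: complex \<Rightarrow> (int^'d \<Rightarrow>\<^sub>0 'v) \<Rightarrow> _"
    by (rule vector_space_pscale) unfold_locales
  have ps: "pscale sV c (Poly_Mapping.single n v) = Poly_Mapping.single n (sV c v)" for n and v
    by (rule poly_mapping_eqI) (simp add: lookup_pscale[OF V.vector_space_axioms] lookup_single when_def)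
  show "F_D \<alpha> b sV \<rho> u r (pscale sV c f) = pscale sV c (F_D \<alpha> b sV \<rho> u r f)"
    by (rule additive_ext[where f = f])
      (simp_all add: add P.scale_right_distrib ps F_D_single gl_act_right V.scale_right_distrib
        mult.commute)
qed

lemma F_D_zero: "F_D \<alpha> b sV \<rho> u r 0 = 0"
  by (simp add: F_D_def)

lemma F_D_diff: "F_D \<alpha> b sV \<rho> u r (f - g) = F_D \<alpha> b sV \<rho> u r f - F_D \<alpha> b sV \<rho> u r g"
  using F_D_right(1)[of \<alpha> b u r "f - g" g] by simp

lemma F_D_sum: "F_D \<alpha> b sV \<rho> u r (\<Sum>a\<in>A. h a) = (\<Sum>a\<in>A. F_D \<alpha> b sV \<rho> u r (h a))"
  by (induction A rule: infinite_finite_induct) (auto simp: F_D_zero F_D_right)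

lemma outer_simps:
  "outer w (u + v) = outer w u + outer w v"
  "outer w (c *s u) = map_matrix ((*) c) (outer w u)"
  "outer (w + w') u = outer w u + outer w' u"
  "outer w 0 = 0"
  by (simp_all add: outer_def vec_eq_iff algebra_simps)

lemma F_D_left:
  "F_D \<alpha> b sV \<rho> (u + v) r f = F_D \<alpha> b sV \<rho> u r f + F_D \<alpha> b sV \<rho> v r f"
  "F_D \<alpha> b sV \<rho> (c *s u) r f = pscale sV c (F_D \<alpha> b sV \<rho> u r f)"
proof -
  interpret P: vector_space "pscale sV :: complex \<Rightarrow> (int^'d \<Rightarrow>\<^sub>0 'v) \<Rightarrow> _"
    by (rule vector_space_pscale) unfold_locales
  have ps: "pscale sV c (Poly_Mapping.single n v) = Poly_Mapping.single n (sV c v)" for n and v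
    by (rule poly_mapping_eqI) (simp add: lookup_pscale[OF V.vector_space_axioms] lookup_single when_def)
  show "F_D \<alpha> b sV \<rho> (u + v) r f = F_D \<alpha> b sV \<rho> u r f + F_D \<alpha> b sV \<rho> v r f"
    by (rule additive_ext[where f = f])
      (simp_all add: F_D_right F_D_single outer_simps bilin_simps gl_act_left V.scale_left_distrib
        single_add[symmetric] ac_simps)
  show "F_D \<alpha> b sV \<rho> (c *s u) r f = pscale sV c (F_D \<alpha> b sV \<rho> u r f)"
    by (rule additive_ext[where f = f])
      (simp_all add: F_D_right F_D_single outer_simps bilin_simps gl_act_left V.scale_right_distrib
        P.scale_right_distrib ps distrib_left)
qed

lemma F_D_zero_left: "F_D \<alpha> b sV \<rho> 0 r f = 0"
  using F_D_left(1)[of \<alpha> b 0 0 r f] by simp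

lemma F_D_bracket:
  "F_D \<alpha> b sV \<rho> (bilin u (int_vec s) *s v - bilin v (int_vec r) *s u) (r + s) f =
     F_D \<alpha> b sV \<rho> u r (F_D \<alpha> b sV \<rho> v s f) - F_D \<alpha> b sV \<rho> v s (F_D \<alpha> b sV \<rho> u r f)"
proof (rule additive_ext[where f = f])
  let ?g = "gl_act b sV \<rho>"
  fix n x
  have om: "outer p u ** outer q v = map_matrix ((*) (bilin u q)) (outer p v)"
    for p q :: "complex^'d" and u v
    by (simp add: vec_eq_iff outer_def matrix_matrix_mult_def bilin_def sum_distrib_left
        sum_distrib_right ac_simps)
  have br: "?g (outer (int_vec r) u) (?g (outer (int_vec s) v) x)
      - ?g (outer (int_vec s) v) (?g (outer (int_vec r) u) x)
      = sV (bilin u (int_vec s)) (?g (outer (int_vec r) v) x)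
        - sV (bilin v (int_vec r)) (?g (outer (int_vec s) u) x)"
  proof -
    have gd: "?g (A - B) x = ?g A x - ?g B x" for A B
      using gl_act_left(1)[of b "A - B" B x] by simp
    show ?thesis
      unfolding gl_act_bracket[symmetric] om gd gl_act_left ..
  qed
  have od: "outer w (u - v) = outer w u - outer w v" for w u v :: "complex^'d"
    by (simp add: outer_def vec_eq_iff algebra_simps)
  have gd: "?g (A - B) x = ?g A x - ?g B x" for A B
    using gl_act_left(1)[of b "A - B" B x] by simp
  let ?w = "bilin u (int_vec s) *s v - bilin v (int_vec r) *s u"
  have "sV (bilin ?w (int_vec n + \<alpha>)) x + ?g (outer (int_vec (r + s)) ?w) x =
     (sV (bilin u (int_vec (n + s) + \<alpha>)) (sV (bilin v (int_vec n + \<alpha>)) x + ?g (outer (int_vec s) v) x)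
      + ?g (outer (int_vec r) u) (sV (bilin v (int_vec n + \<alpha>)) x + ?g (outer (int_vec s) v) x))
     - (sV (bilin v (int_vec (n + r) + \<alpha>)) (sV (bilin u (int_vec n + \<alpha>)) x + ?g (outer (int_vec r) u) x)
      + ?g (outer (int_vec s) v) (sV (bilin u (int_vec n + \<alpha>)) x + ?g (outer (int_vec r) u) x))"
  proof -
    define a c p q where "a = bilin u (int_vec n + \<alpha>)" and "c = bilin v (int_vec n + \<alpha>)"
      and "p = bilin u (int_vec s)" and "q = bilin v (int_vec r)"
    define gru gsu grv gsv where "gru = ?g (outer (int_vec r) u) x" and "gsu = ?g (outer (int_vec s) u) x"
      and "grv = ?g (outer (int_vec r) v) x" and "gsv = ?g (outer (int_vec s) v) x"
    define grs gsr where "grs = ?g (outer (int_vec r) u) gsv" and "gsr = ?g (outer (int_vec s) v) gru"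
    have br': "grs - gsr = sV p grv - sV q gsu"
      using br by (simp add: grs_def gsr_def gru_def gsu_def grv_def gsv_def p_def q_def)
    have 1: "bilin u (int_vec (n + s) + \<alpha>) = a + p" "bilin v (int_vec (n + r) + \<alpha>) = c + q"
      "bilin ?w (int_vec n + \<alpha>) = p * c - q * a"
      by (simp_all add: a_def c_def p_def q_def int_vec_simps bilin_simps algebra_simps)
    have 2: "?g (outer (int_vec (r + s)) ?w) x = sV p grv + sV p gsv - sV q gru - sV q gsu"
      by (simp add: od int_vec_simps outer_simps gl_act_left gd p_def q_def gru_def gsu_def grv_def
          gsv_def V.scale_right_distrib)
    have 3: "?g (outer (int_vec r) u) (sV c x + gsv) = sV c gru + grs"
      "?g (outer (int_vec s) v) (sV a x + gru) = sV a gsv + gsr"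
      by (simp_all add: gl_act_right gru_def gsv_def grs_def gsr_def)
    have "sV (p * c - q * a) x + (sV p grv + sV p gsv - sV q gru - sV q gsu)
        = sV (p * c) x - sV (q * a) x + sV p gsv - sV q gru + (sV p grv - sV q gsu)"
      by (simp add: V.scale_left_diff_distrib)
    also have "\<dots> = (sV (a + p) (sV c x + gsv) + (sV c gru + grs))
        - (sV (c + q) (sV a x + gru) + (sV a gsv + gsr))"
      unfolding br'[symmetric]
      by (simp add: V.scale_left_distrib V.scale_right_distrib mult.commute[of c a] distrib_right)
    finally show ?thesis
      unfolding 1 2 a_def[symmetric] c_def[symmetric] gru_def[symmetric] gsv_def[symmetric] 3 .
  qed
  then show "F_D \<alpha> b sV \<rho> ?w (r + s) (Poly_Mapping.single n x) =
     F_D \<alpha> b sV \<rho> u r (F_D \<alpha> b sV \<rho> v s (Poly_Mapping.single n x))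
     - F_D \<alpha> b sV \<rho> v s (F_D \<alpha> b sV \<rho> u r (Poly_Mapping.single n x))"
    by (simp add: F_D_single single_diff[symmetric] ac_simps)
qed (simp_all add: F_D_right)

lemma F_act_superset:
  assumes "finite R" "W_modes \<delta> \<subseteq> R"
  shows "F_act \<alpha> b sV \<rho> \<delta> f = (\<Sum>r\<in>R. F_D \<alpha> b sV \<rho> (W_coeff \<delta> r) r f)"
  unfolding F_act_def
  by (rule sum.mono_neutral_left[OF assms]) (auto simp: W_modes_def F_D_zero_left)

lemma F_act_D: "F_act \<alpha> b sV \<rho> (D u r) f = F_D \<alpha> b sV \<rho> u r f"
  by (subst F_act_superset[where R = "{r}"]) (auto simp: W_modes_def W_coeff_D split: if_splits)

lemma F_act_add: "F_act \<alpha> b sV \<rho> (\<delta> + \<epsilon>) f = F_act \<alpha> b sV \<rho> \<delta> f + F_act \<alpha> b sV \<rho> \<epsilon> f"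
proof -
  have c: "W_coeff (\<delta> + \<epsilon>) r = W_coeff \<delta> r + W_coeff \<epsilon> r" for r
    by (simp add: W_coeff_def vec_eq_iff lookup_add)
  have "W_modes (\<delta> + \<epsilon>) \<subseteq> W_modes \<delta> \<union> W_modes \<epsilon>"
    by (auto simp: W_modes_def c)
  then have R: "finite (W_modes \<delta> \<union> W_modes \<epsilon>)" "W_modes (\<delta> + \<epsilon>) \<subseteq> W_modes \<delta> \<union> W_modes \<epsilon>"
    "W_modes \<delta> \<subseteq> W_modes \<delta> \<union> W_modes \<epsilon>" "W_modes \<epsilon> \<subseteq> W_modes \<delta> \<union> W_modes \<epsilon>"
    by (simp_all add: finite_W_modes)
  show ?thesis
    unfolding F_act_superset[OF R(1,2)] F_act_superset[OF R(1,3)] F_act_superset[OF R(1,4)]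
    by (simp only: c F_D_left sum.distrib)
qed

lemma F_act_scale: "F_act \<alpha> b sV \<rho> (lie_scale Witt c \<delta>) f = pscale sV c (F_act \<alpha> b sV \<rho> \<delta> f)"
proof -
  interpret P: vector_space "pscale sV :: complex \<Rightarrow> (int^'d \<Rightarrow>\<^sub>0 'v) \<Rightarrow> _"
    by (rule vector_space_pscale) unfold_locales
  have c: "W_coeff (lie_scale Witt c \<delta>) r = c *s W_coeff \<delta> r" for r
    by (simp add: W_coeff_def vec_eq_iff Witt_def lookup_pscale_complex)
  have "W_modes (lie_scale Witt c \<delta>) \<subseteq> W_modes \<delta>"
    by (auto simp: W_modes_def c)
  then show ?thesis
    by (subst F_act_superset[where R = "W_modes \<delta>"])
      (auto simp: finite_W_modes c F_D_left F_act_def P.scale_sum_right)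
qed

lemma F_act_sum: "F_act \<alpha> b sV \<rho> (\<Sum>a\<in>A. h a) f = (\<Sum>a\<in>A. F_act \<alpha> b sV \<rho> (h a) f)"
proof -
  have 0: "F_act \<alpha> b sV \<rho> 0 f = 0"
    using F_act_add[of \<alpha> b 0 0 f] by simp
  show ?thesis
  proof (induction A rule: infinite_finite_induct)
    case (infinite A)
    show ?case
      unfolding sum.infinite[OF infinite.hyps] 0 ..
  next
    case empty
    show ?case
      unfolding sum.empty 0 ..
  next
    case (insert a A)
    show ?case
      unfolding sum.insert[OF insert.hyps] F_act_add insert.IH ..
  qed
qed

theorem F_lie_module: "lie_module Witt (pscale sV) (F_act \<alpha> b sV \<rho>)"
proof -
  interpret W: lie_algebra "Witt :: ('d laurent \<Rightarrow> 'd laurent) lie_data" by (rule Witt_lie_algebra)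
  interpret P: vector_space "pscale sV :: complex \<Rightarrow> (int^'d \<Rightarrow>\<^sub>0 'v) \<Rightarrow> _"
    by (rule vector_space_pscale) unfold_locales
  show ?thesis
  proof
    fix \<delta> \<epsilon> :: "'d laurent \<Rightarrow> 'd laurent" and f
    assume "\<delta> \<in> lie_carrier Witt" "\<epsilon> \<in> lie_carrier Witt"
    then have d: "\<delta> \<in> derivations" and e: "\<epsilon> \<in> derivations" by (simp_all add: Witt_def)
    let ?u = "W_coeff \<delta>" and ?v = "W_coeff \<epsilon>"
    have "lie_bracket Witt \<delta> \<epsilon> = (\<Sum>r\<in>W_modes \<delta>. \<Sum>s\<in>W_modes \<epsilon>. lie_bracket Witt (D (?u r) r) (D (?v s) s))"
    proof
      fix g
      have Dsum: "D u r (\<Sum>a\<in>A. h a) = (\<Sum>a\<in>A. D u r (h a))" for u r A and h :: "int^'d \<Rightarrow> 'd laurent"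
        by (induction A rule: infinite_finite_induct) (auto simp: D_zero D_add)
      have "\<delta> (\<epsilon> g) = (\<Sum>r\<in>W_modes \<delta>. \<Sum>s\<in>W_modes \<epsilon>. D (?u r) r (D (?v s) s g))"
        by (subst derivation_expand[OF d], subst derivation_expand[OF e]) (simp add: Dsum)
      moreover have "\<epsilon> (\<delta> g) = (\<Sum>r\<in>W_modes \<delta>. \<Sum>s\<in>W_modes \<epsilon>. D (?v s) s (D (?u r) r g))"
        by (subst derivation_expand[OF e], subst derivation_expand[OF d], subst sum.swap) (simp add: Dsum)
      ultimately show "lie_bracket Witt \<delta> \<epsilon> g =
          (\<Sum>r\<in>W_modes \<delta>. \<Sum>s\<in>W_modes \<epsilon>. lie_bracket Witt (D (?u r) r) (D (?v s) s)) g"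
        by (simp add: Witt_def sum_fun_apply sum_subtractf)
    qed
    then have "F_act \<alpha> b sV \<rho> (lie_bracket Witt \<delta> \<epsilon>) f =
        (\<Sum>r\<in>W_modes \<delta>. \<Sum>s\<in>W_modes \<epsilon>.
           F_D \<alpha> b sV \<rho> (?u r) r (F_D \<alpha> b sV \<rho> (?v s) s f)
           - F_D \<alpha> b sV \<rho> (?v s) s (F_D \<alpha> b sV \<rho> (?u r) r f))"
      by (simp add: F_act_sum D_bracket F_act_D F_D_bracket)
    also have "\<dots> = F_act \<alpha> b sV \<rho> \<delta> (F_act \<alpha> b sV \<rho> \<epsilon> f) - F_act \<alpha> b sV \<rho> \<epsilon> (F_act \<alpha> b sV \<rho> \<delta> f)"
      using sum.swap[of "\<lambda>r s. F_D \<alpha> b sV \<rho> (?v s) s (F_D \<alpha> b sV \<rho> (?u r) r f)" "W_modes \<epsilon>" "W_modes \<delta>"]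
      by (simp add: F_act_def F_D_sum sum_subtractf)
    finally show "F_act \<alpha> b sV \<rho> (lie_bracket Witt \<delta> \<epsilon>) f =
        F_act \<alpha> b sV \<rho> \<delta> (F_act \<alpha> b sV \<rho> \<epsilon> f) - F_act \<alpha> b sV \<rho> \<epsilon> (F_act \<alpha> b sV \<rho> \<delta> f)" .
  next
    fix \<delta> :: "'d laurent \<Rightarrow> 'd laurent" and f g c
    show "F_act \<alpha> b sV \<rho> \<delta> (f + g) = F_act \<alpha> b sV \<rho> \<delta> f + F_act \<alpha> b sV \<rho> \<delta> g"
      by (simp add: F_act_def F_D_right sum.distrib)
    show "F_act \<alpha> b sV \<rho> \<delta> (pscale sV c f) = pscale sV c (F_act \<alpha> b sV \<rho> \<delta> f)"
      by (simp add: F_act_def F_D_right P.scale_sum_right)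
  qed (simp_all add: F_act_add F_act_scale)
qed

end

end

theory Submission
  imports Defs
begin

text \<open>
  The operators \<open>D(u,0)\<close> act on \<open>V \<otimes> x\<^sup>n\<close> as the scalars \<open>(u | \<lambda>)\<close> with \<open>\<lambda> = n + \<alpha>\<close>, so an isomorphism
  is a family of bijections \<open>\<phi>\<^sub>n : V \<rightarrow> V'\<close> between weight spaces, and \<open>\<alpha> - \<beta>\<close> is integral.  Let
  \<open>\<lambda>\<close> and \<open>r\<close> be linearly independent, let \<open>m = n + r\<close> and \<open>\<delta> = \<phi>\<^sub>m - \<phi>\<^sub>n\<close>, let \<open>gl\<close> act on \<open>Hom(V,V')\<close>
  by commutators, and let \<open>c = b' - b\<close>.  The module relations give \<open>x w\<^sup>T \<cdot> \<phi>\<^sub>n = 0\<close> for \<open>(w | \<lambda>) = 0\<close>,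
  hence \<open>\<lambda> u\<^sup>T \<cdot> \<phi>\<^sub>n = c (u | \<lambda>) \<phi>\<^sub>n\<close>, and the same for \<open>m\<close>; moreover \<open>r u\<^sup>T \<cdot> \<phi>\<^sub>n = (u | \<lambda>) \<delta>\<close>
  and \<open>r u\<^sup>T \<cdot> \<delta> = (u | r) \<delta>\<close>.  The commutation relations of \<open>gl\<close> then force \<open>(c - 1) \<delta> = 0\<close>.
  If \<open>\<delta> = 0\<close>, then \<open>c = 0\<close> and \<open>\<phi>\<^sub>n\<close> is \<open>gl\<close>-equivariant.  The case \<open>c = 1\<close> is impossible, because the
  inverse isomorphism has \<open>-c\<close> in place of \<open>c\<close>.
\<close>

section \<open>Linear maps and rank-one matrices\<close>

lemma linearI_pointwise:
  assumes "vector_space sV" "vector_space sW"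
    and "\<And>x y. f (x + y) = f x + f y" "\<And>c x. f (sV c x) = sW c (f x)"
  shows "Vector_Spaces.linear sV sW f"
  using assms by (auto simp: linear_iff_module_hom module_hom_iff module_iff_vector_space)

lemma linearD_pointwise:
  assumes "Vector_Spaces.linear sV sW f"
  shows "f (x + y) = f x + f y" "f (sV c x) = sW c (f x)" "f (x - y) = f x - f y"
    "f 0 = 0" "f (- x) = - f x"
proof -
  interpret Vector_Spaces.linear sV sW f by fact
  show "f (x + y) = f x + f y" "f (sV c x) = sW c (f x)" "f (x - y) = f x - f y"
    "f 0 = 0" "f (- x) = - f x"
    by (simp_all add: add scale diff zero neg)
qed

lemma outer_right_diff: "outer w (u - v) = outer w u - outer w v"
  by (simp add: outer_def vec_eq_iff algebra_simps)

lemma outer_commutator: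
  "outer p u ** outer q v - outer q v ** outer p u
    = map_matrix ((*) (bilin u q)) (outer p v) - map_matrix ((*) (bilin v p)) (outer q u)"
  by (simp add: vec_eq_iff outer_def matrix_matrix_mult_def bilin_def sum_distrib_left
      sum_distrib_right ac_simps)

lemma bilin_axis: "bilin (axis i c) v = c * v $ i"
  unfolding bilin_def axis_def by (simp add: if_distrib if_distribR cong: if_cong)

text \<open>The unit vectors are integral, so claims about all matrices reduce to the matrices
  \<open>outer (int_vec r) y\<close> that occur in the action of D(y,r).\<close>

lemma matrix_eq_sum_outer:
  fixes A :: "complex^'d^'d"
  shows "A = (\<Sum>k\<in>UNIV. outer (int_vec (axis k 1)) (A $ k))"
proof -
  have "int_vec (axis k 1) $ i * x = (if k = i then x else 0)" for i k :: 'd and x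
    by (simp add: int_vec_def axis_def)
  then show ?thesis
    by (simp add: vec_eq_iff outer_def)
qed

section \<open>Weight components of an intertwiner and the commutator action of gl\<close>

text \<open>\<open>\<phi> n\<close> stands for an intertwiner restricted to degree n. Target degrees
  are relabelled by weight, so the same \<alpha> stands on both sides of \<open>hom\<close>.\<close>

locale tensor_module_hom =
  fixes sV :: "complex \<Rightarrow> 'v::ab_group_add \<Rightarrow> 'v" and \<rho> :: "complex^'d^'d \<Rightarrow> 'v \<Rightarrow> 'v"
    and sW :: "complex \<Rightarrow> 'w::ab_group_add \<Rightarrow> 'w" and \<sigma> :: "complex^'d^'d \<Rightarrow> 'w \<Rightarrow> 'w"
    and \<alpha> :: "complex^'d" and b b' :: complex
    and \<phi> :: "int^'d \<Rightarrow> 'v \<Rightarrow> 'w"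
  assumes V: "lie_module sl sV \<rho>" and W: "lie_module sl sW \<sigma>"
    and linear: "Vector_Spaces.linear sV sW (\<phi> n)"
    and hom: "\<phi> (n + r) (sV (bilin u (int_vec n + \<alpha>)) v + gl_act b sV \<rho> (outer (int_vec r) u) v)
      = sW (bilin u (int_vec n + \<alpha>)) (\<phi> n v) + gl_act b' sW \<sigma> (outer (int_vec r) u) (\<phi> n v)"
begin

sublocale V: lie_module sl sV \<rho> by (rule V)
sublocale W: lie_module sl sW \<sigma> by (rule W)

abbreviation "g \<equiv> gl_act b sV \<rho>"
abbreviation "g' \<equiv> gl_act b' sW \<sigma>"
abbreviation "lin \<equiv> Vector_Spaces.linear sV sW"

definition ad :: "complex^'d^'d \<Rightarrow> ('v \<Rightarrow> 'w) \<Rightarrow> 'v \<Rightarrow> 'w"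
  where "ad A f v = g' A (f v) - f (g A v)"

lemmas g_left = gl_act_left[OF V, where b = b] and g_right = gl_act_right[OF V, where b = b]
lemmas g'_left = gl_act_left[OF W, where b = b'] and g'_right = gl_act_right[OF W, where b = b']

lemma linear_gl_act: "Vector_Spaces.linear sV sV (g A)" "Vector_Spaces.linear sW sW (g' A)"
  by (intro linearI_pointwise V.V.vector_space_axioms W.V.vector_space_axioms g_right g'_right)+

lemma linear_gl_act_left:
  "Vector_Spaces.linear (\<lambda>c. map_matrix ((*) c)) sV (\<lambda>A. g A v)"
  "Vector_Spaces.linear (\<lambda>c. map_matrix ((*) c)) sW (\<lambda>A. g' A w)"
proof -
  have "vector_space (\<lambda>c. map_matrix ((*) c) :: complex^'d^'d \<Rightarrow> _)"
    by unfold_locales (auto simp: vec_eq_iff algebra_simps)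
  then show "Vector_Spaces.linear (\<lambda>c. map_matrix ((*) c)) sV (\<lambda>A. g A v)"
    "Vector_Spaces.linear (\<lambda>c. map_matrix ((*) c)) sW (\<lambda>A. g' A w)"
    by (intro linearI_pointwise V.V.vector_space_axioms W.V.vector_space_axioms g_left g'_left; simp)+
qed

lemmas gl_simps = linearD_pointwise[OF linear_gl_act(1)] linearD_pointwise[OF linear_gl_act(2)]
  linearD_pointwise[OF linear_gl_act_left(1)] linearD_pointwise[OF linear_gl_act_left(2)]

lemma ad_left:
  assumes "lin f"
  shows "ad (A + B) f v = ad A f v + ad B f v" "ad (A - B) f v = ad A f v - ad B f v"
    "ad (map_matrix ((*) c) A) f v = sW c (ad A f v)" "ad 0 f v = 0"
  by (simp_all add: ad_def gl_simps linearD_pointwise[OF assms] W.V.scale_right_diff_distrib)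

lemma ad_sum_left:
  assumes "lin f"
  shows "ad (\<Sum>a\<in>I. A a) f v = (\<Sum>a\<in>I. ad (A a) f v)"
  by (induction I rule: infinite_finite_induct) (simp_all add: ad_left[OF assms])

lemma ad_right:
  "ad A (\<lambda>v. e v + f v) v = ad A e v + ad A f v"
  "ad A (\<lambda>v. e v - f v) v = ad A e v - ad A f v"
  "ad A (\<lambda>v. sW c (f v)) v = sW c (ad A f v)"
  by (simp_all add: ad_def gl_simps W.V.scale_right_diff_distrib)

lemma ad_bracket:
  assumes "lin f"
  shows "ad A (ad B f) v = ad (A ** B - B ** A) f v + ad B (ad A f) v"
  by (simp add: ad_def gl_simps gl_act_bracket[OF V] gl_act_bracket[OF W] linearD_pointwise[OF assms]
      algebra_simps)

text \<open>The identity acts as b on the source and as b' on the target; here the number c = b' - b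
  enters.\<close>

lemma ad_mat_1:
  assumes "lin f"
  shows "ad (mat 1) f v = sW (b' - b) (f v)"
  by (simp add: ad_def gl_act_mat[OF V] gl_act_mat[OF W] linearD_pointwise[OF assms]
      W.V.scale_left_diff_distrib)

section \<open>Rank-one matrices acting on a single weight component\<close>

text \<open>
  The operator \<open>D(u,-r) D(w,r) - D(u,r) D(w,-r)\<close> preserves the weight spaces, and on the space
  of weight \<open>\<lambda> = n + \<alpha>\<close> only the terms odd in \<open>r\<close> survive, that is \<open>2 (u | \<lambda>) r w\<^sup>T\<close>.
\<close>

lemma ad_outer_int_perp:
  assumes u: "bilin u (int_vec n + \<alpha>) = 1" and w: "bilin w (int_vec n + \<alpha>) = 0"
  shows "ad (outer (int_vec r) w) (\<phi> n) v = 0"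
proof -
  define R where "R = (\<lambda>x. outer (int_vec r) x)"
  define p where "p = bilin u (int_vec r)"
  define y where "y = g (R w) v"
  define y' where "y' = g' (R w) (\<phi> n v)"
  have neg: "outer (- q) x = - outer q x" for q x :: "complex^'d"
    by (simp add: outer_def vec_eq_iff)
  have gn: "g (- A) x = - g A x" "g' (- A) z = - g' A z" for A x z
    by (rule gl_simps)+
  note ls = linearD_pointwise[OF linear]
  \<comment> \<open>As w is orthogonal to the weight, the scalar terms of D(w,r) and D(w,-r) vanish
    and only the matrix parts, opposite in sign, remain.\<close>
  have 1: "\<phi> (n + r) y = y'"
    using hom[of n r w v] w by (simp add: y_def y'_def R_def)
  have "\<phi> (n - r) (- y) = - y'"
    using hom[of n "- r" w v] w by (simp add: y_def y'_def R_def int_vec_simps neg gn)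
  then have 2: "\<phi> (n - r) y = y'"
    by (simp add: ls)
  have l: "bilin u (int_vec (n + r) + \<alpha>) = 1 + p" "bilin u (int_vec (n - r) + \<alpha>) = 1 - p"
    using u by (simp_all add: int_vec_simps bilin_simps p_def)
  have 3: "\<phi> n (sV (1 + p) y - g (R u) y) = sW (1 + p) y' - g' (R u) y'"
    using hom[of "n + r" "- r" u y] 1 unfolding l by (simp add: int_vec_simps neg gn R_def)
  have 4: "\<phi> n (sV (1 - p) y + g (R u) y) = sW (1 - p) y' + g' (R u) y'"
    using hom[of "n - r" r u y] 2 unfolding l by (simp add: R_def)
  \<comment> \<open>Adding the round trips through n + r and n - r cancels p and the action of
    \<open>R u\<close>, leaving twice y.\<close>
  have "\<phi> n ((sV (1 + p) y - g (R u) y) + (sV (1 - p) y + g (R u) y))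
      = (sW (1 + p) y' - g' (R u) y') + (sW (1 - p) y' + g' (R u) y')"
    by (simp only: ls(1)[of n "sV (1 + p) y - g (R u) y"] 3 4)
  moreover have "(sV (1 + p) y - g (R u) y) + (sV (1 - p) y + g (R u) y) = sV 2 y"
    using V.V.scale_left_distrib[of "1 + p" "1 - p" y] by simp
  moreover have "(sW (1 + p) y' - g' (R u) y') + (sW (1 - p) y' + g' (R u) y') = sW 2 y'"
    using W.V.scale_left_distrib[of "1 + p" "1 - p" y'] by simp
  ultimately have "sW 2 (\<phi> n y) = sW 2 y'"
    by (simp add: ls)
  then show ?thesis
    by (simp add: ad_def y_def y'_def R_def)
qed

text \<open>Row k of \<open>outer x w\<close> is a multiple of w, hence still orthogonal to the
  weight, so the integral case applies to each summand.\<close>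

lemma ad_outer_perp:
  assumes u: "bilin u (int_vec n + \<alpha>) = 1" and w: "bilin w (int_vec n + \<alpha>) = 0"
  shows "ad (outer x w) (\<phi> n) v = 0"
proof -
  have "outer x w = (\<Sum>k\<in>UNIV. outer (int_vec (axis k 1)) (x $ k *s w))"
    using matrix_eq_sum_outer[of "outer x w"] by (simp add: outer_def vector_scalar_mult_def)
  moreover have "bilin (c *s w) (int_vec n + \<alpha>) = 0" for c
    using w by (simp add: bilin_simps(5))
  ultimately show ?thesis
    by (simp add: ad_sum_left[OF linear] ad_outer_int_perp[OF u])
qed

text \<open>Since (u | \<lambda>) = 1, all rows of the identity minus \<lambda> u^T are orthogonal
  to \<lambda>. This difference annihilates \<open>\<phi> n\<close>, so \<lambda> u^T acts like the
  identity.\<close>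

lemma ad_outer_weight:
  assumes u: "bilin u (int_vec n + \<alpha>) = 1"
  shows "ad (outer (int_vec n + \<alpha>) u) (\<phi> n) v = sW (b' - b) (\<phi> n v)"
proof -
  let ?l = "int_vec n + \<alpha>"
  have row: "(mat 1 - outer ?l u) $ k = axis k 1 - ?l $ k *s u" for k
    by (simp add: vec_eq_iff mat_def outer_def axis_def algebra_simps)
  have "bilin (axis k 1 - ?l $ k *s u) ?l = 0" for k
    by (simp only: bilin_simps(4,5) bilin_axis u) simp
  then have "ad (mat 1 - outer ?l u) (\<phi> n) v = 0"
    by (subst matrix_eq_sum_outer) (simp only: row ad_sum_left[OF linear] ad_outer_perp[OF u] sum.neutral_const)
  then show ?thesis
    by (simp add: ad_left[OF linear] ad_mat_1[OF linear])
qed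

section \<open>Comparing two neighbouring weight components\<close>

text \<open>
  The exterior derivative from \<open>k\<close>-forms to \<open>(k+1)\<close>-forms acts on weight spaces by
  \<open>v \<mapsto> \<lambda> \<and> v\<close> and has \<open>b' = b + 1\<close>, so the first alternative does occur.
\<close>

lemma shift_or_equivariant:
  assumes d: "CARD('d) > 1" and nz: "\<And>n. \<exists>v. \<phi> n v \<noteq> 0"
  shows "b' = b + 1 \<or> b' = b \<and> (\<exists>n. \<forall>A v. \<phi> n (g A v) = g' A (\<phi> n v))"
proof -
  obtain i j :: 'd where ij: "i \<noteq> j"
  proof -
    have "\<not> (\<forall>i j :: 'd. i = j)"
      using d card_le_Suc0_iff_eq[of "UNIV :: 'd set"] by auto
    then show ?thesis using that by blast
  qed
  \<comment> \<open>A nonzero i-th coordinate makes the weight linearly independent of the unit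
    vector in direction j.\<close>
  obtain n where n: "(int_vec n + \<alpha>) $ i \<noteq> 0"
  proof (cases "\<alpha> $ i = 0")
    case True
    then show ?thesis by (intro that[of "axis i 1"]) (simp add: int_vec_def axis_def)
  next
    case False
    then show ?thesis by (intro that[of 0]) (simp add: int_vec_simps)
  qed
  define l where "l = int_vec n + \<alpha>"
  define r :: "int^'d" where "r = axis j 1"
  define s where "s = int_vec r"
  define m where "m = n + r"
  \<comment> \<open>u and w are dual to l and s. At the weight l + s both pair to 1, so either one
    can normalise there.\<close>
  define u :: "complex^'d" where "u = axis i (1 / l $ i)"
  define w :: "complex^'d" where "w = axis j 1 - axis i (l $ j / l $ i)"
  define c where "c = b' - b"
  define f where "f = \<phi> n"
  define \<delta> where "\<delta> = (\<lambda>v. \<phi> m v - \<phi> n v)"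
  have lm: "int_vec m + \<alpha> = l + s"
    by (simp add: m_def l_def s_def int_vec_simps)
  have s: "s $ i = 0" "s $ j = 1"
    using ij by (simp_all add: s_def r_def int_vec_def axis_def)
  have li: "l $ i \<noteq> 0" using n by (simp add: l_def)
  have bl: "bilin u l = 1" "bilin u s = 0" "bilin w l = 0" "bilin w s = 1"
    using li s by (simp_all add: u_def w_def bilin_simps bilin_axis)
  have un: "bilin u (int_vec n + \<alpha>) = 1" and wn: "bilin w (int_vec n + \<alpha>) = 0"
    using bl by (simp_all add: l_def)
  have um: "bilin u (int_vec m + \<alpha>) = 1" and wm: "bilin w (int_vec m + \<alpha>) = 1"
    by (simp_all add: lm bilin_simps bl)
  note ls = linearD_pointwise[OF linear]
  have lf: "lin f" by (simp add: f_def linear)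
  have ld: "lin \<delta>"
    by (intro linearI_pointwise V.V.vector_space_axioms W.V.vector_space_axioms)
      (simp_all add: \<delta>_def ls W.V.scale_right_diff_distrib)
  note lds = linearD_pointwise[OF ld]

  \<comment> \<open>If x is orthogonal to l, step from n to m without a scalar term; if x is
    orthogonal to l + s, step back from m to n. Every x is a sum of two such vectors, w carrying the
    first part.\<close>
  have kill: "\<delta> (g (outer s x) v) = 0" for x v
  proof -
    have 1: "\<delta> (g (outer s x) v) = 0" if "bilin x l = 0" for x v
    proof -
      have "\<phi> m (g (outer s x) v) = g' (outer s x) (\<phi> n v)"
        using hom[of n r x v] that by (simp add: m_def s_def l_def)
      then show ?thesis
        using ad_outer_perp[OF un, of x s v] that by (simp add: \<delta>_def ad_def l_def)
    qed
    have 2: "\<delta> (g (outer s x) v) = 0" if "bilin x (l + s) = 0" for x v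
    proof -
      have neg: "outer (int_vec (- r)) x = - outer s x"
        by (simp add: outer_def vec_eq_iff s_def int_vec_simps)
      have "\<phi> n (g (outer s x) v) = g' (outer s x) (\<phi> m v)"
        using hom[of m "- r" x v] that unfolding lm neg
        by (simp add: m_def gl_simps ls)
      then show ?thesis
        using ad_outer_perp[OF um, of x s v] that by (simp add: \<delta>_def ad_def lm)
    qed
    define t where "t = bilin x (l + s)"
    have "bilin (t *s w) l = 0" "bilin (x - t *s w) (l + s) = 0"
      by (simp_all only: bilin_simps bl t_def) simp_all
    then have "\<delta> (g (outer s (t *s w)) v) + \<delta> (g (outer s (x - t *s w)) v) = 0"
      using 1 2 by simp
    then show ?thesis
      by (simp add: lds(1)[symmetric] gl_simps(1)[symmetric] outer_right_diff gl_simps)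
  qed
  have ad_n: "ad (outer s x) f v = sW (bilin x l) (\<delta> v)" for x v
    using hom[of n r x v] kill[of x v] unfolding m_def[symmetric] s_def[symmetric] l_def[symmetric]
    by (simp add: ls f_def \<delta>_def ad_def W.V.scale_right_diff_distrib algebra_simps)
  have ad_m: "ad (outer s x) (\<phi> m) v = sW (bilin x (l + s)) (\<delta> v)" for x v
  proof -
    have neg: "outer (int_vec (- r)) x = - outer s x"
      by (simp add: outer_def vec_eq_iff s_def int_vec_simps)
    have "\<phi> n (sV (bilin x (l + s)) v - g (outer s x) v)
        = sW (bilin x (l + s)) (\<phi> m v) - g' (outer s x) (\<phi> m v)"
      using hom[of m "- r" x v] unfolding lm neg by (simp add: m_def gl_simps)
    then show ?thesis
      using kill[of x v]
      by (simp add: ls \<delta>_def ad_def W.V.scale_right_diff_distrib algebra_simps)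
  qed
  have ad_s_\<delta>: "ad (outer s w) \<delta> v = \<delta> v" for v
    using ad_n[of w v] ad_m[of w v] unfolding \<delta>_def ad_right
    by (simp add: bilin_simps bl f_def)

  define H where "H = outer l u"
  define X where "X = outer l w"
  have H_f: "ad H f = (\<lambda>v. sW c (f v))"
    using ad_outer_weight[OF un] by (auto simp: H_def l_def c_def f_def)
  have s_f: "ad (outer s u) f = \<delta>"
    using ad_n[of u] by (auto simp: bl)
  have HX: "H ** X - X ** H = X" and Hs: "H ** outer s u - outer s u ** H = - outer s u"
    by (simp_all add: H_def X_def outer_commutator bl) (simp_all add: vec_eq_iff)
  \<comment> \<open>f has H-eigenvalue c, and \<open>outer s u\<close>, which lowers it by 1, sends
    f to \<delta>.\<close>
  have H_\<delta>: "ad H \<delta> = (\<lambda>v. sW (c - 1) (\<delta> v))"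
  proof
    fix v
    have "ad H (ad (outer s u) f) v = ad (- outer s u) f v + ad (outer s u) (ad H f) v"
      unfolding ad_bracket[OF lf, of H "outer s u"] Hs ..
    moreover have "ad (- outer s u) f v = - ad (outer s u) f v"
      using ad_left(2)[OF lf, of 0 "outer s u" v] by (simp add: ad_left(4)[OF lf])
    ultimately show "ad H \<delta> v = sW (c - 1) (\<delta> v)"
      by (simp add: H_f s_f ad_right W.V.scale_left_diff_distrib)
  qed
  \<comment> \<open>At m, normalised by w, the matrix \<open>X + outer s w\<close> acts on
    \<open>\<phi> m\<close> as c, while both summands annihilate \<open>\<phi> n\<close> and the
    second fixes \<delta>.\<close>
  have X_\<delta>: "ad X \<delta> = (\<lambda>v. sW c (f v) + sW (c - 1) (\<delta> v))"
  proof
    fix v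
    have "ad (X + outer s w) (\<phi> m) v = sW c (\<phi> m v)"
      using ad_outer_weight[OF wm, of v] by (simp add: lm outer_simps[OF V] X_def c_def)
    moreover have "ad X (\<phi> n) v = 0" "ad (outer s w) (\<phi> n) v = 0"
      using ad_outer_perp[OF un wn] by (simp_all add: X_def)
    ultimately have "ad X \<delta> v + ad (outer s w) \<delta> v = sW c (\<phi> m v)"
      unfolding \<delta>_def ad_right by (simp add: ad_left[OF linear])
    moreover have "\<phi> m v = f v + \<delta> v" by (simp add: f_def \<delta>_def)
    ultimately show "ad X \<delta> v = sW c (f v) + sW (c - 1) (\<delta> v)"
      by (simp add: ad_s_\<delta> W.V.scale_left_diff_distrib W.V.scale_right_distrib algebra_simps)
  qed
  \<comment> \<open>Apply [H, X] = X to \<delta>: the two evaluations share the term c^2 f, and the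
    rest reads (c - 1)^2 \<delta> = c (c - 1) \<delta>.\<close>
  have key: "sW (c - 1) (\<delta> v) = 0" for v
  proof -
    have "ad H (ad X \<delta>) v = ad X \<delta> v + ad X (ad H \<delta>) v"
      unfolding ad_bracket[OF ld, of H X] HX ..
    also have "\<dots> = sW c (sW c (f v)) + sW c (sW (c - 1) (\<delta> v))"
      unfolding H_\<delta> ad_right
      by (simp add: X_\<delta> W.V.scale_left_diff_distrib W.V.scale_right_distrib left_diff_distrib)
    finally have "sW c (sW c (f v)) + sW (c - 1) (sW (c - 1) (\<delta> v))
        = sW c (sW c (f v)) + sW c (sW (c - 1) (\<delta> v))"
      unfolding X_\<delta> ad_right by (simp add: H_f H_\<delta>)
    then have "sW (c - 1) (sW (c - 1) (\<delta> v)) = sW c (sW (c - 1) (\<delta> v))"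
      by simp
    then show ?thesis
      unfolding W.V.scale_left_diff_distrib[of c 1] by simp
  qed
  show ?thesis
  proof (cases "c = 1")
    case True
    then show ?thesis by (simp add: c_def algebra_simps)
  next
    case False
    then have \<delta>0: "\<delta> v = 0" for v
      using key[of v] by simp
    have "ad X \<delta> v = 0" for v
      by (simp add: ad_def \<delta>0 gl_simps)
    then have "sW c (f v) = 0" for v
      using \<delta>0 by (simp add: X_\<delta>)
    then have c0: "c = 0"
      using nz[of n] by (auto simp: f_def)
    have "\<phi> m = \<phi> n"
      using \<delta>0 by (auto simp: \<delta>_def)
    \<comment> \<open>One and the same map now satisfies the orthogonality relations at both
      weights, and the hyperplanes orthogonal to l and to l + s together span everything.\<close>
    then have perp: "ad (outer x y) f v = 0" if "bilin y l = 0 \<or> bilin y (l + s) = 0" for x y v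
      using that ad_outer_perp[OF un, of y] ad_outer_perp[OF um, of y]
      by (auto simp: f_def lm l_def)
    have ad_outer: "ad (outer x y) f v = 0" for x y v
    proof -
      define t where "t = bilin y (l + s)"
      have "bilin (t *s w) l = 0" "bilin (y - t *s w) (l + s) = 0"
        by (simp_all only: bilin_simps bl t_def) simp_all
      then have "ad (outer x (t *s w)) f v + ad (outer x (y - t *s w)) f v = 0"
        using perp by simp
      then show ?thesis
        by (simp add: outer_right_diff ad_left[OF lf])
    qed
    have "ad A f v = 0" for A v
      by (subst matrix_eq_sum_outer) (simp add: ad_sum_left[OF lf] ad_outer)
    then have "\<forall>A v. \<phi> n (g A v) = g' A (\<phi> n v)"
      by (simp add: ad_def f_def)
    moreover have "b' = b"
      using c0 by (simp add: c_def)
    ultimately show ?thesis by blast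
  qed
qed

end

section \<open>Splitting a homomorphism of the tensor modules by weights\<close>

lemma pscale_single:
  assumes "vector_space sV"
  shows "pscale sV c (Poly_Mapping.single n v) = Poly_Mapping.single n (sV c v)"
proof -
  interpret vector_space sV by fact
  show ?thesis
    by (rule poly_mapping_eqI) (simp add: lookup_pscale[OF assms] lookup_single when_def)
qed

lemma lookup_F_D_0:
  fixes \<alpha> :: "complex^'d"
  assumes V: "lie_module sl sV \<rho>"
  shows "Poly_Mapping.lookup (F_D \<alpha> b sV \<rho> u 0 f) k
    = sV (bilin u (int_vec k + \<alpha>)) (Poly_Mapping.lookup f k)"
proof -
  interpret lie_module sl sV \<rho> by (rule V)
  have [simp]: "outer 0 u = (0 :: complex^'d^'d)"
    by (simp add: outer_def vec_eq_iff)
  have eq: "F_D \<alpha> b sV \<rho> u 0 f = (\<Sum>n\<in>Poly_Mapping.keys f. Poly_Mapping.single n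
       (sV (bilin u (int_vec n + \<alpha>)) (Poly_Mapping.lookup f n)))"
    by (simp add: F_D_def int_vec_simps gl_act_zero_left[OF V])
  have "Poly_Mapping.lookup (F_D \<alpha> b sV \<rho> u 0 f) k = (\<Sum>n\<in>Poly_Mapping.keys f.
       if n = k then sV (bilin u (int_vec k + \<alpha>)) (Poly_Mapping.lookup f k) else 0)"
    unfolding eq lookup_sum by (intro sum.cong) (auto simp: lookup_single when_def)
  then show ?thesis
    by (simp add: in_keys_iff)
qed

text \<open>Compare the eigenvalues of D(u,0) in degree n of the source and degree k of the target;
  the unit vectors u separate weights.\<close>

lemma hom_weight:
  fixes \<alpha> \<beta> :: "complex^'d"
  assumes V: "lie_module sl sV \<rho>" and W: "lie_module sl sW \<sigma>"
    and lin: "Vector_Spaces.linear (pscale sV) (pscale sW) \<Phi>"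
    and hom: "\<And>u r f. \<Phi> (F_D \<alpha> b sV \<rho> u r f) = F_D \<beta> b' sW \<sigma> u r (\<Phi> f)"
    and k: "Poly_Mapping.lookup (\<Phi> (Poly_Mapping.single n v)) k \<noteq> 0"
  shows "int_vec k + \<beta> = int_vec n + \<alpha>"
proof -
  interpret V: lie_module sl sV \<rho> by (rule V)
  interpret W: lie_module sl sW \<sigma> by (rule W)
  let ?x = "Poly_Mapping.single n v"
  have "bilin u (int_vec k + \<beta>) = bilin u (int_vec n + \<alpha>)" for u
  proof -
    have "F_D \<alpha> b sV \<rho> u 0 ?x = pscale sV (bilin u (int_vec n + \<alpha>)) ?x"
      by (rule poly_mapping_eqI)
        (simp add: lookup_F_D_0[OF V] lookup_pscale[OF V.V.vector_space_axioms] lookup_single when_def)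
    then have "F_D \<beta> b' sW \<sigma> u 0 (\<Phi> ?x) = pscale sW (bilin u (int_vec n + \<alpha>)) (\<Phi> ?x)"
      by (simp add: hom[symmetric] linearD_pointwise[OF lin])
    then have "sW (bilin u (int_vec k + \<beta>)) (Poly_Mapping.lookup (\<Phi> ?x) k)
        = sW (bilin u (int_vec n + \<alpha>)) (Poly_Mapping.lookup (\<Phi> ?x) k)"
      by (metis lookup_F_D_0[OF W] lookup_pscale[OF W.V.vector_space_axioms])
    then show ?thesis
      using k by simp
  qed
  from this[of "axis i 1" for i] show ?thesis
    by (simp add: vec_eq_iff bilin_axis)
qed

lemma hom_weight_single:
  fixes \<alpha> \<beta> :: "complex^'d"
  assumes V: "lie_module sl sV \<rho>" and W: "lie_module sl sW \<sigma>"
    and lin: "Vector_Spaces.linear (pscale sV) (pscale sW) \<Phi>"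
    and hom: "\<And>u r f. \<Phi> (F_D \<alpha> b sV \<rho> u r f) = F_D \<beta> b' sW \<sigma> u r (\<Phi> f)"
    and \<gamma>: "\<alpha> - \<beta> = int_vec \<gamma>"
  shows "\<Phi> (Poly_Mapping.single n v) =
    Poly_Mapping.single (n + \<gamma>) (Poly_Mapping.lookup (\<Phi> (Poly_Mapping.single n v)) (n + \<gamma>))"
proof (rule poly_mapping_eqI)
  fix k
  have "Poly_Mapping.lookup (\<Phi> (Poly_Mapping.single n v)) k = 0" if "k \<noteq> n + \<gamma>"
  proof (rule ccontr)
    assume "Poly_Mapping.lookup (\<Phi> (Poly_Mapping.single n v)) k \<noteq> 0"
    from hom_weight[OF V W lin hom this] have "int_vec k = int_vec (n + \<gamma>)"
      using \<gamma> by (simp add: int_vec_simps \<gamma>[symmetric] algebra_simps)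
    then have "k = n + \<gamma>"
      by (simp add: int_vec_def vec_eq_iff flip: of_int_add)
    then show False using that by simp
  qed
  then show "Poly_Mapping.lookup (\<Phi> (Poly_Mapping.single n v)) k = Poly_Mapping.lookup
      (Poly_Mapping.single (n + \<gamma>) (Poly_Mapping.lookup (\<Phi> (Poly_Mapping.single n v)) (n + \<gamma>))) k"
    by (auto simp: lookup_single when_def)
qed

text \<open>Degree n + \<gamma> of the target has the weight n + \<alpha>, so intertwining D(u,r) on
  v(n) becomes exactly the relation \<open>hom\<close> of the locale.\<close>

lemma tensor_module_hom_components:
  fixes \<alpha> \<beta> :: "complex^'d"
  assumes V: "lie_module sl sV \<rho>" and W: "lie_module sl sW \<sigma>"
    and lin: "Vector_Spaces.linear (pscale sV) (pscale sW) \<Phi>"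
    and hom: "\<And>u r f. \<Phi> (F_D \<alpha> b sV \<rho> u r f) = F_D \<beta> b' sW \<sigma> u r (\<Phi> f)"
    and \<gamma>: "\<alpha> - \<beta> = int_vec \<gamma>"
  shows "tensor_module_hom sV \<rho> sW \<sigma> \<alpha> b b'
    (\<lambda>n v. Poly_Mapping.lookup (\<Phi> (Poly_Mapping.single n v)) (n + \<gamma>))"
    (is "tensor_module_hom _ _ _ _ _ _ _ ?\<phi>")
proof (rule tensor_module_hom.intro[OF V W])
  interpret V: lie_module sl sV \<rho> by (rule V)
  interpret W: lie_module sl sW \<sigma> by (rule W)
  fix n
  show "Vector_Spaces.linear sV sW (?\<phi> n)"
    by (intro linearI_pointwise V.V.vector_space_axioms W.V.vector_space_axioms)
      (simp_all add: single_add linearD_pointwise[OF lin] lookup_add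
        pscale_single[OF V.V.vector_space_axioms, symmetric] lookup_pscale[OF W.V.vector_space_axioms])
  fix r u v
  let ?a = "bilin u (int_vec n + \<alpha>)"
  have e: "int_vec (n + \<gamma>) + \<beta> = int_vec n + \<alpha>"
    by (simp add: int_vec_simps \<gamma>[symmetric])
  have "\<Phi> (Poly_Mapping.single (n + r) (sV ?a v + gl_act b sV \<rho> (outer (int_vec r) u) v))
      = F_D \<beta> b' sW \<sigma> u r (Poly_Mapping.single (n + \<gamma>) (?\<phi> n v))"
    using hom[of u r "Poly_Mapping.single n v"] hom_weight_single[OF V W lin hom \<gamma>, of n v]
    by (simp add: F_D_single[OF V])
  also have "\<dots> = Poly_Mapping.single (n + r + \<gamma>)
      (sW ?a (?\<phi> n v) + gl_act b' sW \<sigma> (outer (int_vec r) u) (?\<phi> n v))"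
    by (simp add: F_D_single[OF W] e add.assoc add.commute[of \<gamma> r])
  finally show "?\<phi> (n + r) (sV ?a v + gl_act b sV \<rho> (outer (int_vec r) u) v)
      = sW ?a (?\<phi> n v) + gl_act b' sW \<sigma> (outer (int_vec r) u) (?\<phi> n v)"
    by simp
qed

section \<open>The two directions of the isomorphism criterion\<close>

lemma isomorphic_imp:
  fixes \<alpha> \<beta> :: "complex^'d"
  assumes d: "CARD('d) > 1"
    and V: "lie_module sl sV \<rho>" and W: "lie_module sl sW \<sigma>"
    and ne: "\<exists>v :: 'v::ab_group_add. v \<noteq> 0"
    and lin: "Vector_Spaces.linear (pscale sV) (pscale sW) \<Phi>" and bij: "bij \<Phi>"
    and hom: "\<And>u r f. \<Phi> (F_D \<alpha> b sV \<rho> u r f) = F_D \<beta> b' sW \<sigma> u r (\<Phi> f)"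
  shows "b = b' \<and> \<alpha> - \<beta> \<in> range int_vec
    \<and> lie_module_isomorphic sl sV (\<rho> :: _ \<Rightarrow> 'v \<Rightarrow> _) sW (\<sigma> :: _ \<Rightarrow> 'w::ab_group_add \<Rightarrow> _)"
proof -
  interpret V: lie_module sl sV \<rho> by (rule V)
  interpret W: lie_module sl sW \<sigma> by (rule W)
  define \<Psi> where "\<Psi> = inv \<Phi>"
  have \<Psi>\<Phi>: "\<Psi> (\<Phi> f) = f" and \<Phi>\<Psi>: "\<Phi> (\<Psi> g) = g" for f g
    using bij by (simp_all add: \<Psi>_def bij_is_inj bij_is_surj surj_f_inv_f)
  note ls = linearD_pointwise[OF lin]
  have lin': "Vector_Spaces.linear (pscale sW) (pscale sV) \<Psi>"
    by (intro linearI_pointwise vector_space_pscale V.V.vector_space_axioms W.V.vector_space_axioms)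
      (metis ls(1,2) \<Phi>\<Psi> \<Psi>\<Phi>)+
  have hom': "\<Psi> (F_D \<beta> b' sW \<sigma> u r g) = F_D \<alpha> b sV \<rho> u r (\<Psi> g)" for u r g
    by (metis hom \<Phi>\<Psi> \<Psi>\<Phi>)
  have \<Phi>0: "\<Phi> f = 0 \<longleftrightarrow> f = 0" for f
    by (metis ls(4) \<Psi>\<Phi>)
  obtain v0 :: 'v where v0: "v0 \<noteq> 0" using ne by blast
  then have "\<Phi> (Poly_Mapping.single 0 v0) \<noteq> 0"
    by (metis \<Phi>0 lookup_single_eq lookup_zero)
  then obtain k where k: "Poly_Mapping.lookup (\<Phi> (Poly_Mapping.single 0 v0)) k \<noteq> 0"
    by (metis lookup_zero poly_mapping_eqI)
  \<comment> \<open>A nonzero component from degree 0 to degree k equates the weights \<alpha> and k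
    + \<beta>.\<close>
  have \<gamma>: "\<alpha> - \<beta> = int_vec k"
    using hom_weight[OF V W lin hom k] by (simp add: int_vec_simps algebra_simps)
  then have \<gamma>': "\<beta> - \<alpha> = int_vec (- k)"
    by (simp add: int_vec_simps algebra_simps flip: \<gamma>)
  define \<phi> where "\<phi> = (\<lambda>n v. Poly_Mapping.lookup (\<Phi> (Poly_Mapping.single n v)) (n + k))"
  define \<psi> where "\<psi> = (\<lambda>n v. Poly_Mapping.lookup (\<Psi> (Poly_Mapping.single n v)) (n - k))"
  have \<phi>: "\<Phi> (Poly_Mapping.single n v) = Poly_Mapping.single (n + k) (\<phi> n v)" for n v
    unfolding \<phi>_def by (rule hom_weight_single[OF V W lin hom \<gamma>])
  have \<psi>: "\<Psi> (Poly_Mapping.single n v) = Poly_Mapping.single (n - k) (\<psi> n v)" for n v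
    unfolding \<psi>_def using hom_weight_single[OF W V lin' hom' \<gamma>'] by simp
  interpret h: tensor_module_hom sV \<rho> sW \<sigma> \<alpha> b b' \<phi>
    unfolding \<phi>_def by (rule tensor_module_hom_components[OF V W lin hom \<gamma>])
  interpret h': tensor_module_hom sW \<sigma> sV \<rho> \<beta> b' b \<psi>
    unfolding \<psi>_def using tensor_module_hom_components[OF W V lin' hom' \<gamma>'] by simp
  have \<phi>\<psi>: "\<phi> n (\<psi> (n + k) w) = w" and \<psi>\<phi>: "\<psi> (n + k) (\<phi> n v) = v" for n v w
    using \<Phi>\<Psi>[of "Poly_Mapping.single (n + k) w"] \<Psi>\<Phi>[of "Poly_Mapping.single n v"]
    by (simp_all add: \<phi> \<psi>) (metis lookup_single_eq)+
  have nz: "\<exists>v. \<phi> n v \<noteq> 0" for n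
    by (metis \<psi>\<phi> v0 linearD_pointwise(4)[OF h'.linear])
  have nz': "\<exists>w. \<psi> n w \<noteq> 0" for n
    using \<psi>\<phi>[of "n - k" v0] v0 by (intro exI[of _ "\<phi> (n - k) v0"]) simp
  have alt: "b' = b + 1 \<or> b' = b \<and> (\<exists>n. \<forall>A v. \<phi> n (gl_act b sV \<rho> A v) = gl_act b' sW \<sigma> A (\<phi> n v))"
    by (rule h.shift_or_equivariant[OF d nz])
  \<comment> \<open>The dichotomy for the inverse swaps b and b'; both of its cases contradict b' =
    b + 1.\<close>
  have "b = b' + 1 \<or> b = b'"
    using h'.shift_or_equivariant[OF d nz'] by blast
  then have "b' \<noteq> b + 1"
    by auto
  with alt obtain n where b: "b' = b"
    and n: "\<And>A v. \<phi> n (gl_act b sV \<rho> A v) = gl_act b' sW \<sigma> A (\<phi> n v)"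
    by blast
  have "\<phi> n (\<rho> A v) = \<sigma> A (\<phi> n v)" if "A \<in> lie_carrier sl" for A v
    using n[of A v] that by (simp add: sl_def gl_act_sl[OF V] gl_act_sl[OF W])
  moreover have "bij (\<phi> n)"
    by (rule bijI') (metis \<psi>\<phi>, metis \<phi>\<psi>)
  ultimately show ?thesis
    using b \<gamma> h.linear[of n] unfolding lie_module_isomorphic_def by blast
qed

text \<open>The isomorphism is v(n) to \<psi>(v)(n + \<gamma>): multiplying by x^\<gamma>
  compensates the change from \<alpha> to \<beta>.\<close>

lemma isomorphic_shift:
  fixes \<alpha> \<beta> :: "complex^'d"
  assumes V: "lie_module sl sV \<rho>" and W: "lie_module sl sW \<sigma>"
    and \<gamma>: "\<alpha> - \<beta> = int_vec \<gamma>" and iso: "lie_module_isomorphic sl sV \<rho> sW \<sigma>"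
  shows "lie_module_isomorphic Witt (pscale sV) (F_act \<alpha> b sV \<rho>) (pscale sW) (F_act \<beta> b sW \<sigma>)"
proof -
  interpret V: lie_module sl sV \<rho> by (rule V)
  interpret W: lie_module sl sW \<sigma> by (rule W)
  obtain \<psi> where lin: "Vector_Spaces.linear sV sW \<psi>" and bij: "bij \<psi>"
    and hom: "\<And>A v. A \<in> lie_carrier sl \<Longrightarrow> \<psi> (\<rho> A v) = \<sigma> A (\<psi> v)"
    using iso unfolding lie_module_isomorphic_def by blast
  note ls = linearD_pointwise[OF lin]
  have gl: "\<psi> (gl_act b sV \<rho> A v) = gl_act b sW \<sigma> A (\<psi> v)" for A v
    by (simp add: gl_act_def ls hom[OF traceless_part[OF V]])
  \<comment> \<open>\<open>Poly_Mapping.map\<close> applies its function only to nonzero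
    coefficients, so the lookup formula for \<open>\<Psi>\<close> relies on this value.\<close>
  have inv0: "inv \<psi> 0 = 0"
    using bij ls(4) by (metis bij_inv_eq_iff)
  define \<Phi> where "\<Phi> f = Poly_Mapping.map_key (\<lambda>k. k - \<gamma>) (Poly_Mapping.map \<psi> f)" for f :: "int^'d \<Rightarrow>\<^sub>0 _"
  define \<Psi> where "\<Psi> g = Poly_Mapping.map_key (\<lambda>k. k + \<gamma>) (Poly_Mapping.map (inv \<psi>) g)" for g :: "int^'d \<Rightarrow>\<^sub>0 _"
  have \<Phi>: "Poly_Mapping.lookup (\<Phi> f) k = \<psi> (Poly_Mapping.lookup f (k - \<gamma>))" for f k
    by (simp add: \<Phi>_def map_key.rep_eq inj_on_def map.rep_eq when_def ls)
  have \<Psi>: "Poly_Mapping.lookup (\<Psi> g) k = inv \<psi> (Poly_Mapping.lookup g (k + \<gamma>))" for g k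
    by (simp add: \<Psi>_def map_key.rep_eq inj_on_def map.rep_eq when_def inv0)
  have bij\<Phi>: "bij \<Phi>"
  proof (rule o_bij[of \<Psi>])
    show "\<Psi> \<circ> \<Phi> = id" "\<Phi> \<circ> \<Psi> = id"
      using bij by (auto intro!: poly_mapping_eqI simp: fun_eq_iff \<Phi> \<Psi> bij_is_inj bij_is_surj surj_f_inv_f)
  qed
  have add: "\<Phi> (f + g) = \<Phi> f + \<Phi> g" for f g
    by (rule poly_mapping_eqI) (simp add: \<Phi> lookup_add ls)
  have lin\<Phi>: "Vector_Spaces.linear (pscale sV) (pscale sW) \<Phi>"
    by (intro linearI_pointwise vector_space_pscale V.V.vector_space_axioms W.V.vector_space_axioms add)
      (rule poly_mapping_eqI, simp add: \<Phi> ls lookup_pscale[OF V.V.vector_space_axioms]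
        lookup_pscale[OF W.V.vector_space_axioms])
  have single: "\<Phi> (Poly_Mapping.single n v) = Poly_Mapping.single (n + \<gamma>) (\<psi> v)" for n v
    by (rule poly_mapping_eqI) (auto simp: \<Phi> lookup_single when_def ls)
  have e: "\<beta> + int_vec (n + \<gamma>) = \<alpha> + int_vec n" for n
    by (simp add: int_vec_simps \<gamma>[symmetric])
  have F_D: "\<Phi> (F_D \<alpha> b sV \<rho> u r f) = F_D \<beta> b sW \<sigma> u r (\<Phi> f)" for u r f
    by (rule additive_ext[where f = f])
      (simp_all add: add F_D_right[OF V] F_D_right[OF W] single F_D_single[OF V] F_D_single[OF W]
        e gl ls ac_simps)
  have "\<Phi> (\<Sum>a\<in>A. h a) = (\<Sum>a\<in>A. \<Phi> (h a))" for A and h :: "int^'d \<Rightarrow> _"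
    by (induction A rule: infinite_finite_induct) (simp_all add: add linearD_pointwise(4)[OF lin\<Phi>])
  then have "\<Phi> (F_act \<alpha> b sV \<rho> x f) = F_act \<beta> b sW \<sigma> x (\<Phi> f)" for x f
    by (simp add: F_act_def F_D)
  then show ?thesis
    using lin\<Phi> bij\<Phi> unfolding lie_module_isomorphic_def by blast
qed

theorem theorem2p6:
  fixes \<alpha> \<beta> :: "complex^'d" and b b' :: complex
    and sV :: "complex \<Rightarrow> 'v::ab_group_add \<Rightarrow> 'v" and \<rho> :: "complex^'d^'d \<Rightarrow> 'v \<Rightarrow> 'v"
    and sV' :: "complex \<Rightarrow> 'w::ab_group_add \<Rightarrow> 'w" and \<rho>' :: "complex^'d^'d \<Rightarrow> 'w \<Rightarrow> 'w"
  assumes "CARD('d) > 1"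
    and "irreducible_lie_module sl sV \<rho>"
    and "irreducible_lie_module sl sV' \<rho>'"
  shows "lie_module_isomorphic Witt (pscale sV) (F_act \<alpha> b sV \<rho>) (pscale sV') (F_act \<beta> b' sV' \<rho>') \<longleftrightarrow>
    b = b' \<and> \<alpha> - \<beta> \<in> range int_vec \<and> lie_module_isomorphic sl sV \<rho> sV' \<rho>'"
proof -
  have V: "lie_module sl sV \<rho>" and ne: "\<exists>v :: 'v. v \<noteq> 0" and W: "lie_module sl sV' \<rho>'"
    using assms(2,3) by (simp_all add: irreducible_lie_module_def)
  show ?thesis
  proof
    assume "lie_module_isomorphic Witt (pscale sV) (F_act \<alpha> b sV \<rho>) (pscale sV') (F_act \<beta> b' sV' \<rho>')"
    then obtain \<Phi> where \<Phi>: "Vector_Spaces.linear (pscale sV) (pscale sV') \<Phi>" "bij \<Phi>"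
      and hom: "\<And>x f. x \<in> lie_carrier Witt \<Longrightarrow> \<Phi> (F_act \<alpha> b sV \<rho> x f) = F_act \<beta> b' sV' \<rho>' x (\<Phi> f)"
      unfolding lie_module_isomorphic_def by blast
    have "\<Phi> (F_D \<alpha> b sV \<rho> u r f) = F_D \<beta> b' sV' \<rho>' u r (\<Phi> f)" for u r f
      using hom[of "D u r" f] by (simp add: Witt_def D_derivation F_act_D[OF V] F_act_D[OF W])
    from isomorphic_imp[OF assms(1) V W ne \<Phi> this]
    show "b = b' \<and> \<alpha> - \<beta> \<in> range int_vec \<and> lie_module_isomorphic sl sV \<rho> sV' \<rho>'" .
  next
    assume "b = b' \<and> \<alpha> - \<beta> \<in> range int_vec \<and> lie_module_isomorphic sl sV \<rho> sV' \<rho>'"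
    then show "lie_module_isomorphic Witt (pscale sV) (F_act \<alpha> b sV \<rho>) (pscale sV') (F_act \<beta> b' sV' \<rho>')"
      using isomorphic_shift[OF V W] by blast
  qed
qed

end
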